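(* In the projection-structure setting described in the context (observation $Y=\theta+\sigma\xi$, structures $\mathcal I$, subspaces $\mathbb L_I$, projections $\mathrm P_I$, estimator $\hat\theta$, selector $\hat I$, oracle $I_o$, $\tau_0$-oracle $I_*$, radius $\hat r^2=\sigma^2+\sigma^2\rho(\hat I)$), assume: (A1) for some $\alpha\in(0,1]$ and nonnegative $(d_I)_{I\in\mathcal I}$, $\ \sup_{\theta\in\Theta}\log\mathbb E_\theta\exp\{\alpha\|\mathrm P_I\xi\|^2\}\le d_I$ for all $I\in\mathcal I$; (A2) for some $\nu,C_\nu>0$, $\ \sum_{I\in\mathcal I}e^{-\nu\rho(I)}\le C_\nu$, and $\rho(I)\ge d_I$ for all $I\in\mathcal I$; (A3) for any $I_0,I_1\in\mathcal I$ there exists $I'\in\mathcal I$ with $\mathbb L_{I_0}\cup\mathbb L_{I_1}\subseteq\mathbb L_{I'}$ and $\rho(I')\le\rho(I_0)+\rho(I_1)$. For $t\ge0$ let $$\Theta_{\rm eb}(t)=\big\{\theta\in\Theta:\ \|\theta-\mathrm P_{I_*}\theta\|^2\le t\sigma^2(1+\rho(I_* ))\big\}.$$ Then there exist constants $M_2,M_3,H_2,H_3,m_2,m_3>0$ such that for any $t,M\ge0$, with $\hat R_M^2=(t+1)M_2\hat r^2+(t+2)M\sigma^2$, $$\sup_{\theta\in\Theta_{\rm eb}(t)}\mathbb P_\theta\big(\theta\notin B(\hat\theta,\hat R_M)\big)\le H_2e^{-m_2M},$$ and, for all $\theta\in\Theta$, $$\mathbb P_\theta\big(\hat r^2\ge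 M_3r^2(\theta)+(M+1)\sigma^2\big)\le H_3e^{-m_3M}.$$ The second relation holds uniformly in $\theta\in\Theta$ also without (A3). Moreover, if instead of (A3) the following stronger condition holds: for any $I_0,I_1\in\mathcal I$ there exist $I',I''\in\mathcal I$ with $\mathbb L_{I'}=\mathbb L_{I_0}+\mathbb L_{I_1}$, $\mathbb L_{I''}=\mathbb L_{I_0}\cap\mathbb L_{I_1}$, $\rho(I')\le\rho(I_0)+\rho(I_1)$, $\rho(I'')\le\rho(I_0)$, then there is a constant $M_0'>0$ such that for all $\theta\in\Theta$ and $M\ge0$ $$\mathbb P_\theta\big(\hat r^2\ge M_0'\rho(I_o)\sigma^2+(M+1)\sigma^2\big)\le C_\nu e^{-M/2}.$$
   Context: Setting. $\mathcal Y=\mathbb R^N$ with Euclidean norm $\|\cdot\|$, $\Theta\subseteq\mathcal Y$ (by default $\Theta=\mathcal Y$), $B(\theta_0,R)=\{\theta\in\Theta:\|\theta-\theta_0\|\le R\}$. For each $\theta\in\Theta$, under $\mathbb P_\theta$ (expectation $\mathbb E_\theta$) one observes $Y=\theta+\sigma\xi$, where $\sigma>0$ is known and $\mathbb E_\theta\xi=0$; the law of $\xi$ is otherwise unspecified and may depend on $\theta$. $\mathcal I$ is a finite or countable set (family of structures); to each $I\in\mathcal I$ is associated a linear subspace $\mathbb L_I\subseteq\mathcal Y$ with orthogonal projection $\mathrm P_I$. $\rho:\mathcal I\to[0,\infty)$ is a function (majorant of the structure complexity). Estimators. With $\alpha,\nu$ the constants in (A1), (A2), fix $\varkappa>(32\nu+10+\alpha)/(4\alpha)$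 and put $\lambda_I=e^{-\varkappa\rho(I)}$, $$\tilde\pi(I|Y)=\frac{\lambda_I\exp\{-\|Y-\mathrm P_IY\|^2/(2\sigma^2)\}}{\sum_{J\in\mathcal I}\lambda_J\exp\{-\|Y-\mathrm P_JY\|^2/(2\sigma^2)\}},\quad \tilde\theta=\sum_{I\in\mathcal I}(\mathrm P_IY)\tilde\pi(I|Y),$$ $\hat I\in\arg\max_I\tilde\pi(I|Y)=\arg\min_I\{\|Y-\mathrm P_IY\|^2+2\varkappa\sigma^2\rho(I)\}$, $\check\theta=\mathrm P_{\hat I}Y$. $\hat\theta$ denotes either $\tilde\theta$ or $\check\theta$ (the statement holds for both). The data dependent quadratic radius is $\hat r^2=\sigma^2+\sigma^2\rho(\hat I)$. Oracles. $r^2(I,\theta)=\|\theta-\mathrm P_I\theta\|^2+\sigma^2\rho(I)$, $r^2(\theta)=\min_{I\in\mathcal I}r^2(I,\theta)$. For $s>0$ let $I_o(\theta,s)$ be a minimizer over $I\in\mathcal I$ of $\|\theta-\mathrm P_I\theta\|^2+s\rho(I)$. The oracle is $I_o=I_o(\theta,\sigma^2)$. Put $\bar\tau=3(1+\varkappa\alpha)/\alpha$; fix $\delta\in(0,1)$ and $\tau_0>\frac{1+\delta}{1-\delta}\bar\tau$; the $\tau_0$-oracle is $I_*=I_*(\theta)=I_o(\theta,\tau_0\sigma^2)$. *)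

theory Defs
  imports "HOL-Probability.Probability"
begin

definition orth_proj :: "(real^'n) set \<Rightarrow> real^'n \<Rightarrow> real^'n" where
  "orth_proj V x = (THE y. y \<in> V \<and> (\<forall>z\<in>V. orthogonal (x - y) z))"

lemma orth_proj_ex1:
  fixes V :: "(real^'n) set"
  assumes "subspace V"
  shows "\<exists>!y. y \<in> V \<and> (\<forall>z\<in>V. orthogonal (x - y) z)"
proof -
  obtain y z where yz: "y \<in> span V" "\<And>w. w \<in> span V \<Longrightarrow> orthogonal z w" "x = y + z"
    using orthogonal_subspace_decomp_exists[of V x] by metis
  show ?thesis
  proof (rule ex1I[of _ y])
    show "y \<in> V \<and> (\<forall>w\<in>V. orthogonal (x - y) w)"
      using yz assms by (metis add_diff_cancel_left' span_eq_iff)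
  next
    fix u assume u: "u \<in> V \<and> (\<forall>w\<in>V. orthogonal (x - u) w)"
    have yV: "y \<in> V" using yz assms by (metis span_eq_iff)
    then have "u - y \<in> V" using u assms subspace_diff by blast
    then have "(x - u) \<bullet> (u - y) = 0" "(x - y) \<bullet> (u - y) = 0"
      using u yz assms by (auto simp: orthogonal_def span_base)
    then have "(u - y) \<bullet> (u - y) = 0" by (simp add: inner_diff_left)
    then show "u = y" by simp
  qed
qed

lemma orth_proj:
  fixes V :: "(real^'n) set"
  assumes "subspace V"
  shows "orth_proj V x \<in> V" "z \<in> V \<Longrightarrow> orthogonal (x - orth_proj V x) z"
  using theI'[OF orth_proj_ex1[OF assms, of x]] unfolding orth_proj_def by blast+

text \<open>
  The family of laws is indexed by the parameter: under \<open>P \<theta>\<close> the noise is the random vector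
  \<open>\<xi> \<theta>\<close>, so that its law may depend on \<open>\<theta>\<close>, and the observation is \<open>obs \<sigma> \<xi> \<theta>\<close>.
\<close>

definition obs :: "real \<Rightarrow> (real^'n \<Rightarrow> 'w \<Rightarrow> real^'n) \<Rightarrow> real^'n \<Rightarrow> 'w \<Rightarrow> real^'n" where
  "obs \<sigma> \<xi> \<theta> \<omega> = \<theta> + \<sigma> *\<^sub>R \<xi> \<theta> \<omega>"

definition projection_model ::
  "real \<Rightarrow> (real^'n) set \<Rightarrow> (real^'n \<Rightarrow> 'w measure) \<Rightarrow> (real^'n \<Rightarrow> 'w \<Rightarrow> real^'n)
    \<Rightarrow> 'i set \<Rightarrow> ('i \<Rightarrow> (real^'n) set) \<Rightarrow> ('i \<Rightarrow> real) \<Rightarrow> bool" where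
  "projection_model \<sigma> \<Theta> P \<xi> \<I> L \<rho> \<longleftrightarrow>
     \<sigma> > 0 \<and>
     (\<forall>\<theta>\<in>\<Theta>. prob_space (P \<theta>) \<and> \<xi> \<theta> \<in> borel_measurable (P \<theta>) \<and>
        integrable (P \<theta>) (\<xi> \<theta>) \<and> integral\<^sup>L (P \<theta>) (\<xi> \<theta>) = 0) \<and>
     countable \<I> \<and> \<I> \<noteq> {} \<and>
     (\<forall>I\<in>\<I>. subspace (L I) \<and> \<rho> I \<ge> 0)"

definition pball :: "(real^'n) set \<Rightarrow> real^'n \<Rightarrow> real \<Rightarrow> (real^'n) set" where
  "pball \<Theta> \<theta>0 R = {\<theta>\<in>\<Theta>. norm (\<theta> - \<theta>0) \<le> R}"

definition unnorm_weight ::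
  "real \<Rightarrow> real \<Rightarrow> ('i \<Rightarrow> (real^'n) set) \<Rightarrow> ('i \<Rightarrow> real) \<Rightarrow> 'i \<Rightarrow> real^'n \<Rightarrow> real" where
  "unnorm_weight \<kappa> \<sigma> L \<rho> I y =
     exp (- \<kappa> * \<rho> I) * exp (- (norm (y - orth_proj (L I) y))\<^sup>2 / (2 * \<sigma>\<^sup>2))"

definition pi_tilde ::
  "real \<Rightarrow> real \<Rightarrow> 'i set \<Rightarrow> ('i \<Rightarrow> (real^'n) set) \<Rightarrow> ('i \<Rightarrow> real) \<Rightarrow> 'i \<Rightarrow> real^'n \<Rightarrow> real" where
  "pi_tilde \<kappa> \<sigma> \<I> L \<rho> I y =
     unnorm_weight \<kappa> \<sigma> L \<rho> I y / (\<Sum>\<^sub>\<infinity>J\<in>\<I>. unnorm_weight \<kappa> \<sigma> L \<rho> J y)"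

definition theta_tilde ::
  "real \<Rightarrow> real \<Rightarrow> 'i set \<Rightarrow> ('i \<Rightarrow> (real^'n) set) \<Rightarrow> ('i \<Rightarrow> real) \<Rightarrow> real^'n \<Rightarrow> real^'n" where
  "theta_tilde \<kappa> \<sigma> \<I> L \<rho> y =
     (\<Sum>\<^sub>\<infinity>I\<in>\<I>. pi_tilde \<kappa> \<sigma> \<I> L \<rho> I y *\<^sub>R orth_proj (L I) y)"

text \<open>
  \<open>Ihat\<close> is an arbitrary version of the arg max.  Its measurability (ties can always be broken
  measurably, \<open>\<I>\<close> being countable) makes the events in the theorem measurable.
\<close>

definition selector ::
  "real \<Rightarrow> real \<Rightarrow> 'i set \<Rightarrow> ('i \<Rightarrow> (real^'n) set) \<Rightarrow> ('i \<Rightarrow> real) \<Rightarrow> (real^'n \<Rightarrow> 'i) \<Rightarrow> bool" where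
  "selector \<kappa> \<sigma> \<I> L \<rho> Ihat \<longleftrightarrow>
     Ihat \<in> borel \<rightarrow>\<^sub>M count_space \<I> \<and>
     (\<forall>y. is_arg_max (\<lambda>I. pi_tilde \<kappa> \<sigma> \<I> L \<rho> I y) (\<lambda>I. I \<in> \<I>) (Ihat y))"

definition theta_check ::
  "('i \<Rightarrow> (real^'n) set) \<Rightarrow> (real^'n \<Rightarrow> 'i) \<Rightarrow> real^'n \<Rightarrow> real^'n" where
  "theta_check L Ihat y = orth_proj (L (Ihat y)) y"

text \<open>The squared radii \<open>r\<^sup>2\<close> are defined directly, not as squares.\<close>

definition rhat2 :: "real \<Rightarrow> ('i \<Rightarrow> real) \<Rightarrow> (real^'n \<Rightarrow> 'i) \<Rightarrow> real^'n \<Rightarrow> real" where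
  "rhat2 \<sigma> \<rho> Ihat y = \<sigma>\<^sup>2 + \<sigma>\<^sup>2 * \<rho> (Ihat y)"

definition r2 ::
  "real \<Rightarrow> ('i \<Rightarrow> (real^'n) set) \<Rightarrow> ('i \<Rightarrow> real) \<Rightarrow> 'i \<Rightarrow> real^'n \<Rightarrow> real" where
  "r2 \<sigma> L \<rho> I \<theta> = (norm (\<theta> - orth_proj (L I) \<theta>))\<^sup>2 + \<sigma>\<^sup>2 * \<rho> I"

text \<open>
  The infimum is attained under (A2), which leaves only finitely many \<open>I\<close> with \<open>\<rho> I\<close> below any
  given level.
\<close>

definition oracle_r2 ::
  "real \<Rightarrow> 'i set \<Rightarrow> ('i \<Rightarrow> (real^'n) set) \<Rightarrow> ('i \<Rightarrow> real) \<Rightarrow> real^'n \<Rightarrow> real" where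
  "oracle_r2 \<sigma> \<I> L \<rho> \<theta> = (INF I\<in>\<I>. r2 \<sigma> L \<rho> I \<theta>)"

definition is_oracle ::
  "'i set \<Rightarrow> ('i \<Rightarrow> (real^'n) set) \<Rightarrow> ('i \<Rightarrow> real) \<Rightarrow> real^'n \<Rightarrow> real \<Rightarrow> 'i \<Rightarrow> bool" where
  "is_oracle \<I> L \<rho> \<theta> s I \<longleftrightarrow>
     is_arg_min (\<lambda>I. (norm (\<theta> - orth_proj (L I) \<theta>))\<^sup>2 + s * \<rho> I) (\<lambda>I. I \<in> \<I>) I"

definition cond_A1 ::
  "real \<Rightarrow> ('i \<Rightarrow> real) \<Rightarrow> (real^'n) set \<Rightarrow> (real^'n \<Rightarrow> 'w measure)
    \<Rightarrow> (real^'n \<Rightarrow> 'w \<Rightarrow> real^'n) \<Rightarrow> 'i set \<Rightarrow> ('i \<Rightarrow> (real^'n) set) \<Rightarrow> bool" where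
  "cond_A1 \<alpha> d \<Theta> P \<xi> \<I> L \<longleftrightarrow>
     (\<forall>I\<in>\<I>. d I \<ge> 0 \<and>
        (\<forall>\<theta>\<in>\<Theta>. integrable (P \<theta>) (\<lambda>\<omega>. exp (\<alpha> * (norm (orth_proj (L I) (\<xi> \<theta> \<omega>)))\<^sup>2)) \<and>
           ln (\<integral>\<omega>. exp (\<alpha> * (norm (orth_proj (L I) (\<xi> \<theta> \<omega>)))\<^sup>2) \<partial>P \<theta>) \<le> d I))"

definition cond_A2 :: "real \<Rightarrow> real \<Rightarrow> ('i \<Rightarrow> real) \<Rightarrow> 'i set \<Rightarrow> ('i \<Rightarrow> real) \<Rightarrow> bool" where
  "cond_A2 \<nu> C\<^sub>\<nu> d \<I> \<rho> \<longleftrightarrow>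
     (\<lambda>I. exp (- \<nu> * \<rho> I)) summable_on \<I> \<and> (\<Sum>\<^sub>\<infinity>I\<in>\<I>. exp (- \<nu> * \<rho> I)) \<le> C\<^sub>\<nu> \<and>
     (\<forall>I\<in>\<I>. \<rho> I \<ge> d I)"

definition cond_A3 :: "'i set \<Rightarrow> ('i \<Rightarrow> (real^'n) set) \<Rightarrow> ('i \<Rightarrow> real) \<Rightarrow> bool" where
  "cond_A3 \<I> L \<rho> \<longleftrightarrow>
     (\<forall>I0\<in>\<I>. \<forall>I1\<in>\<I>. \<exists>I'\<in>\<I>. L I0 \<union> L I1 \<subseteq> L I' \<and> \<rho> I' \<le> \<rho> I0 + \<rho> I1)"

definition cond_A3_strong :: "'i set \<Rightarrow> ('i \<Rightarrow> (real^'n) set) \<Rightarrow> ('i \<Rightarrow> real) \<Rightarrow> bool" where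
  "cond_A3_strong \<I> L \<rho> \<longleftrightarrow>
     (\<forall>I0\<in>\<I>. \<forall>I1\<in>\<I>. \<exists>I'\<in>\<I>. \<exists>I''\<in>\<I>.
        L I' = {x + y |x y. x \<in> L I0 \<and> y \<in> L I1} \<and> L I'' = L I0 \<inter> L I1 \<and>
        \<rho> I' \<le> \<rho> I0 + \<rho> I1 \<and> \<rho> I'' \<le> \<rho> I0)"

definition Theta_eb ::
  "real \<Rightarrow> (real^'n) set \<Rightarrow> ('i \<Rightarrow> (real^'n) set) \<Rightarrow> ('i \<Rightarrow> real) \<Rightarrow> (real^'n \<Rightarrow> 'i)
    \<Rightarrow> real \<Rightarrow> (real^'n) set" where
  "Theta_eb \<sigma> \<Theta> L \<rho> Istar t =
     {\<theta>\<in>\<Theta>. (norm (\<theta> - orth_proj (L (Istar \<theta>)) \<theta>))\<^sup>2 \<le> t * \<sigma>\<^sup>2 * (1 + \<rho> (Istar \<theta>))}"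

end

theory Submission
  imports Defs
begin

text \<open>
  Fix a reference structure \<open>I0\<close>.  By (A3) every \<open>I\<close> has an upper bound \<open>S I\<close> with
  \<open>L I \<union> L I0 \<subseteq> L (S I)\<close>.  A Chernoff bound and a union bound show that, outside an event of
  probability at most \<open>C\<^sub>\<nu> exp (- m)\<close>, the squared norms of all the noise projections onto the
  \<open>L (S I)\<close> are below \<open>((1 + \<nu>) \<rho> I + \<rho> I0 + m) / \<alpha>\<close>.  On the good event everything is
  deterministic: since \<open>Ihat\<close> minimizes the penalized residual, comparing it with the oracle bounds
  \<open>\<rho> Ihat\<close> from above, comparing it with \<open>S Ihat\<close> bounds it from below in terms of the
  \<open>\<tau>0\<close>-oracle, and the posterior weights decay exponentially in the risk of the structure.
  Coverage is the combination of the last two facts.  Without (A3), one uses instead the projection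
  of the noise onto the span of all structures, which finitely many of them control.
\<close>

section \<open>Orthogonal projections, residuals and their perturbation\<close>

lemma orth_proj_eqI:
  fixes V :: "(real^'n) set"
  assumes "subspace V" "p \<in> V" "\<And>z. z \<in> V \<Longrightarrow> orthogonal (x - p) z"
  shows "orth_proj V x = p"
  using orth_proj_ex1[OF assms(1), of x] orth_proj[OF assms(1)] assms(2,3) by metis

lemma linear_orth_proj:
  fixes V :: "(real^'n) set"
  assumes V: "subspace V"
  shows "linear (orth_proj V)"
proof (rule linearI)
  fix x y :: "real^'n" and c :: real
  show "orth_proj V (x + y) = orth_proj V x + orth_proj V y"
  proof (rule orth_proj_eqI[OF V])
    show "orth_proj V x + orth_proj V y \<in> V"
      using V orth_proj(1) subspace_add by blast
    show "orthogonal (x + y - (orth_proj V x + orth_proj V y)) z" if "z \<in> V" for z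
      using orth_proj(2)[OF V that, of x] orth_proj(2)[OF V that, of y]
      by (simp add: orthogonal_def inner_diff_left inner_add_left)
  qed
  show "orth_proj V (c *\<^sub>R x) = c *\<^sub>R orth_proj V x"
  proof (rule orth_proj_eqI[OF V])
    show "c *\<^sub>R orth_proj V x \<in> V"
      using V orth_proj(1) subspace_scale by blast
    show "orthogonal (c *\<^sub>R x - c *\<^sub>R orth_proj V x) z" if "z \<in> V" for z
      using orth_proj(2)[OF V that, of x]
      by (simp add: orthogonal_def inner_diff_left)
  qed
qed

abbreviation sqdist :: "(real^'n) set \<Rightarrow> real^'n \<Rightarrow> real" where
  "sqdist V x \<equiv> (norm (x - orth_proj V x))\<^sup>2"

text \<open>The residual at W is orthogonal to W, which contains the difference of the two
  projections. A difference of squared residuals for nested subspaces is thus a square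
  itself.\<close>

lemma sqdist_nested:
  fixes V W :: "(real^'n) set"
  assumes V: "subspace V" and W: "subspace W" and VW: "V \<subseteq> W"
  shows "sqdist V x = sqdist W x + (norm (orth_proj W x - orth_proj V x))\<^sup>2"
proof -
  have "orth_proj W x - orth_proj V x \<in> W"
    using orth_proj(1)[OF V] orth_proj(1)[OF W] VW W subspace_diff by blast
  then have "orthogonal (x - orth_proj W x) (orth_proj W x - orth_proj V x)"
    using orth_proj(2)[OF W] by blast
  from norm_add_Pythagorean[OF this] show ?thesis by simp
qed

lemma sqdist_mono:
  fixes V W :: "(real^'n) set"
  assumes "subspace V" "subspace W" "V \<subseteq> W"
  shows "sqdist W x \<le> sqdist V x"
  using sqdist_nested[OF assms, of x] by simp

lemma orth_proj_Pythagorean: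
  fixes V :: "(real^'n) set"
  assumes V: "subspace V"
  shows "(norm x)\<^sup>2 = sqdist V x + (norm (orth_proj V x))\<^sup>2"
proof -
  have "orthogonal (x - orth_proj V x) (orth_proj V x)"
    using orth_proj[OF V] by blast
  from norm_add_Pythagorean[OF this] show ?thesis by simp
qed

lemma norm_orth_proj_le:
  fixes V :: "(real^'n) set"
  assumes "subspace V"
  shows "norm (orth_proj V x) \<le> norm x"
  using orth_proj_Pythagorean[OF assms, of x] by (simp add: power2_le_imp_le)

lemma norm_orth_proj_diff:
  fixes V W :: "(real^'n) set"
  assumes "subspace V" "subspace W" "V \<subseteq> W"
  shows "(norm (orth_proj W x))\<^sup>2
    = (norm (orth_proj V x))\<^sup>2 + (norm (orth_proj W x - orth_proj V x))\<^sup>2"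
  using sqdist_nested[OF assms, of x] orth_proj_Pythagorean[OF assms(1), of x]
    orth_proj_Pythagorean[OF assms(2), of x] by simp

text \<open>Young's inequality, from expanding the square of \<open>c *\<^sub>R a - b\<close>. The
  free weight c trades the first term against the second.\<close>

lemma norm_add_sq_le:
  fixes a b :: "'a::real_inner"
  assumes "c > 0"
  shows "(norm (a + b))\<^sup>2 \<le> (1 + c) * (norm a)\<^sup>2 + (1 + 1 / c) * (norm b)\<^sup>2"
proof -
  have "0 \<le> (norm (c *\<^sub>R a - b))\<^sup>2 / c" using assms by simp
  also have "\<dots> = c * (norm a)\<^sup>2 + (norm b)\<^sup>2 / c - 2 * (a \<bullet> b)"
    using assms unfolding power2_norm_eq_inner
    by (simp add: inner_diff_left inner_diff_right inner_commute[of b a] field_simps)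
  finally show ?thesis
    by (simp add: power2_norm_eq_inner inner_add_left inner_add_right inner_commute[of b a]
        algebra_simps)
qed

text \<open>By nesting, the gap of squared residuals is the squared norm of the linear map
  \<open>?D\<close>, so Young's inequality applies to it. Only the part of z inside W enters, which
  is what keeps the noise term within reach of (A1).\<close>

lemma sqdist_gap_perturb:
  fixes V W :: "(real^'n) set"
  assumes V: "subspace V" and W: "subspace W" and VW: "V \<subseteq> W" and c: "c > 0"
  shows "sqdist V (x + s *\<^sub>R z) - sqdist W (x + s *\<^sub>R z)
    \<le> (1 + c) * (sqdist V x - sqdist W x) + (1 + 1 / c) * (s\<^sup>2 * (norm (orth_proj W z))\<^sup>2)"
proof -
  let ?D = "\<lambda>u. orth_proj W u - orth_proj V u"
  have gap: "sqdist V u - sqdist W u = (norm (?D u))\<^sup>2" for u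
    using sqdist_nested[OF V W VW] by simp
  have "?D (x + s *\<^sub>R z) = ?D x + s *\<^sub>R ?D z"
    using linear_orth_proj[OF V] linear_orth_proj[OF W]
    by (simp add: linear_add linear_scale algebra_simps)
  then have "(norm (?D (x + s *\<^sub>R z)))\<^sup>2 \<le> (1 + c) * (norm (?D x))\<^sup>2
      + (1 + 1 / c) * (s\<^sup>2 * (norm (?D z))\<^sup>2)"
    using norm_add_sq_le[OF c, of "?D x" "s *\<^sub>R ?D z"] by (simp add: power_mult_distrib)
  also have "\<dots> \<le> (1 + c) * (norm (?D x))\<^sup>2
      + (1 + 1 / c) * (s\<^sup>2 * (norm (orth_proj W z))\<^sup>2)"
    using norm_orth_proj_diff[OF V W VW, of z] c
    by (intro add_left_mono mult_left_mono) auto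
  finally show ?thesis unfolding gap .
qed

text \<open>Bias and noise separate: the bias is orthogonal to V and the projected noise lies in
  V.\<close>

lemma orth_proj_estimation_error:
  fixes V :: "(real^'n) set"
  assumes V: "subspace V"
  shows "(norm (x - orth_proj V (x + s *\<^sub>R z)))\<^sup>2
    = sqdist V x + s\<^sup>2 * (norm (orth_proj V z))\<^sup>2"
proof -
  have "orthogonal (x - orth_proj V x) (- (s *\<^sub>R orth_proj V z))"
    using orth_proj[OF V] by (simp add: orthogonal_def)
  from norm_add_Pythagorean[OF this] show ?thesis
    using linear_orth_proj[OF V]
    by (simp add: linear_add linear_scale power_mult_distrib algebra_simps)
qed

section \<open>Union bounds and exponential tails for noise projections\<close>

lemma (in prob_space) prob_countable_Union_le:
  assumes "countable J" and sets: "\<And>j. j \<in> J \<Longrightarrow> A j \<in> events"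
    and le: "\<And>j. j \<in> J \<Longrightarrow> prob (A j) \<le> f j"
    and f: "f summable_on J" "\<And>j. j \<in> J \<Longrightarrow> 0 \<le> f j"
  shows "prob (\<Union>j\<in>J. A j) \<le> infsum f J"
proof (cases "J = {}")
  case False
  define e where "e = from_nat_into J"
  have e: "e n \<in> J" for n unfolding e_def using False by (rule from_nat_into)
  let ?B = "\<lambda>n. \<Union>k<n. A (e k)"
  have range: "range e = J"
    unfolding e_def using False \<open>countable J\<close> by (rule range_from_nat_into)
  have "prob (?B n) \<le> infsum f J" for n
  proof -
    \<comment> \<open>Summing over the image set counts each index once, although \<open>e\<close>
      repeats indices when J is finite.\<close>
    have "?B n = (\<Union>j\<in>e ` {..<n}. A j)" by auto
    also have "prob \<dots> \<le> (\<Sum>j\<in>e ` {..<n}. prob (A j))"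
      using sets e by (intro finite_measure_subadditive_finite) auto
    also have "\<dots> \<le> sum f (e ` {..<n})"
      using le e by (intro sum_mono) auto
    also have "\<dots> \<le> infsum f J"
      using e f by (intro finite_sum_le_infsum) auto
    finally show ?thesis .
  qed
  moreover have "(\<lambda>n. prob (?B n)) \<longlonglongrightarrow> prob (\<Union>n. ?B n)"
    using sets e by (intro finite_Lim_measure_incseq) (auto simp: incseq_def intro: less_le_trans)
  moreover have "(\<Union>n. ?B n) = (\<Union>j\<in>J. A j)"
    unfolding range[symmetric] by auto
  ultimately show ?thesis
    by (metis LIMSEQ_le_const2)
qed simp

lemma borel_measurable_orth_proj [measurable]:
  fixes V :: "(real^'n) set"
  assumes "subspace V"
  shows "orth_proj V \<in> borel_measurable borel"
  using linear_orth_proj[OF assms]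
  by (intro borel_measurable_continuous_onI linear_continuous_on linear_conv_bounded_linear[THEN iffD1])

text \<open>Chernoff bound, with the exponential moment of (A1) at the fixed exponent
  \<alpha>.\<close>

lemma (in prob_space) orth_proj_tail:
  fixes V :: "(real^'n) set"
  assumes "subspace V" and [measurable]: "\<xi> \<in> borel_measurable M" and "0 < \<alpha>"
    and int: "integrable M (\<lambda>\<omega>. exp (\<alpha> * (norm (orth_proj V (\<xi> \<omega>)))\<^sup>2))"
    and ln: "ln (\<integral>\<omega>. exp (\<alpha> * (norm (orth_proj V (\<xi> \<omega>)))\<^sup>2) \<partial>M) \<le> d"
  shows "{\<omega>\<in>space M. x \<le> \<alpha> * (norm (orth_proj V (\<xi> \<omega>)))\<^sup>2} \<in> events"
    and "prob {\<omega>\<in>space M. x \<le> \<alpha> * (norm (orth_proj V (\<xi> \<omega>)))\<^sup>2} \<le> exp (d - x)"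
proof -
  let ?f = "\<lambda>\<omega>. \<alpha> * (norm (orth_proj V (\<xi> \<omega>)))\<^sup>2"
  have [measurable]: "(\<lambda>\<omega>. orth_proj V (\<xi> \<omega>)) \<in> borel_measurable M"
    using measurable_compose[OF assms(2) borel_measurable_orth_proj[OF assms(1)]] .
  show "{\<omega>\<in>space M. x \<le> ?f \<omega>} \<in> events" by measurable
  \<comment> \<open>The moment is at least 1, hence positive, so the bound on its logarithm can be
    exponentiated.\<close>
  have "1 = (\<integral>\<omega>. (1::real) \<partial>M)" by (simp add: prob_space)
  also have "\<dots> \<le> (\<integral>\<omega>. exp (?f \<omega>) \<partial>M)"
    using \<open>0 < \<alpha>\<close> by (intro integral_mono int) auto
  finally have "(\<integral>\<omega>. exp (?f \<omega>) \<partial>M) \<le> exp d"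
    using ln by (metis exp_ln exp_le_cancel_iff less_le_trans zero_less_one)
  moreover have "prob {\<omega>\<in>space M. x \<le> ?f \<omega>} \<le> exp (- x) * (\<integral>\<omega>. exp (?f \<omega>) \<partial>M)"
    using Chernoff_ineq_ge[of 1 "space M" ?f x] int
    by (simp add: set_integrable_def set_lebesgue_integral_def
        cong: Bochner_Integration.integrable_cong Bochner_Integration.integral_cong)
  ultimately have "prob {\<omega>\<in>space M. x \<le> ?f \<omega>} \<le> exp (- x) * exp d"
    by (meson exp_ge_zero mult_left_mono order_trans)
  then show "prob {\<omega>\<in>space M. x \<le> ?f \<omega>} \<le> exp (d - x)"
    by (simp add: exp_add[symmetric])
qed

text \<open>The threshold grows with I: since \<open>\<rho> (S I) \<le> \<rho> I + r\<close>, the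
  tail bound leaves the exponent \<open>- \<nu> * \<rho> I - m\<close>, whose exponentials are
  summable by (A2). The union runs over I and not over the values \<open>S I\<close>, so S may
  repeat values.\<close>

lemma (in prob_space) uniform_noise_bound:
  fixes L :: "'i \<Rightarrow> (real^'n) set" and m :: real
  assumes "countable \<I>" and meas: "\<xi> \<in> borel_measurable M" and "0 < \<alpha>"
    and sub: "\<And>I. I \<in> \<I> \<Longrightarrow> subspace (L I)"
    and int: "\<And>I. I \<in> \<I> \<Longrightarrow> integrable M (\<lambda>\<omega>. exp (\<alpha> * (norm (orth_proj (L I) (\<xi> \<omega>)))\<^sup>2))"
    and ln: "\<And>I. I \<in> \<I> \<Longrightarrow> ln (\<integral>\<omega>. exp (\<alpha> * (norm (orth_proj (L I) (\<xi> \<omega>)))\<^sup>2) \<partial>M) \<le> \<rho> I"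
    and S: "\<And>I. I \<in> \<I> \<Longrightarrow> S I \<in> \<I>" "\<And>I. I \<in> \<I> \<Longrightarrow> \<rho> (S I) \<le> \<rho> I + r"
    and summable: "(\<lambda>I. exp (- \<nu> * \<rho> I)) summable_on \<I>"
  defines "bad \<equiv> \<Union>I\<in>\<I>. {\<omega>\<in>space M.
      (1 + \<nu>) * \<rho> I + r + m \<le> \<alpha> * (norm (orth_proj (L (S I)) (\<xi> \<omega>)))\<^sup>2}"
  shows "bad \<in> events" "prob bad \<le> (\<Sum>\<^sub>\<infinity>I\<in>\<I>. exp (- \<nu> * \<rho> I)) * exp (- m)"
proof -
  note tail = orth_proj_tail[OF sub meas \<open>0 < \<alpha>\<close> int ln, OF S(1) S(1) S(1)]
  show "bad \<in> events"
    unfolding bad_def using \<open>countable \<I>\<close> tail(1) by (intro sets.countable_UN') auto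
  have "prob bad \<le> (\<Sum>\<^sub>\<infinity>I\<in>\<I>. exp (- \<nu> * \<rho> I) * exp (- m))"
    unfolding bad_def
  proof (rule prob_countable_Union_le[OF \<open>countable \<I>\<close> tail(1)])
    fix I assume I: "I \<in> \<I>"
    have "exp (\<rho> (S I) - ((1 + \<nu>) * \<rho> I + r + m)) \<le> exp (- \<nu> * \<rho> I + - m)"
      using S(2)[OF I] by (simp add: algebra_simps)
    then show "prob {\<omega>\<in>space M. (1 + \<nu>) * \<rho> I + r + m \<le> \<alpha> * (norm (orth_proj (L (S I)) (\<xi> \<omega>)))\<^sup>2}
        \<le> exp (- \<nu> * \<rho> I) * exp (- m)"
      using tail(2)[OF I I I, of "(1 + \<nu>) * \<rho> I + r + m"] unfolding exp_add by linarith
  qed (use summable_on_cmult_left[OF summable, of "exp (- m)"] in auto)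
  then show "prob bad \<le> (\<Sum>\<^sub>\<infinity>I\<in>\<I>. exp (- \<nu> * \<rho> I)) * exp (- m)"
    by (simp add: infsum_cmult_left')
qed

text \<open>
  \<open>x \<mapsto> (\<Sum>b\<in>B. (x \<bullet> b) b) + (x - P x)\<close>, with \<open>B\<close> a basis of the span and \<open>P\<close> the projection
  onto it, is an injective linear map, hence bounded below.
\<close>

lemma orth_proj_span_Union_le:
  fixes L :: "'i \<Rightarrow> (real^'n) set"
  assumes sub: "\<And>I. I \<in> \<I> \<Longrightarrow> subspace (L I)"
  obtains F C where "finite F" "F \<subseteq> \<I>" "0 < C"
    "\<And>x. norm (orth_proj (span (\<Union>I\<in>\<I>. L I)) x) \<le> C * (\<Sum>I\<in>F. norm (orth_proj (L I) x))"
proof -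
  define W where "W = span (\<Union>I\<in>\<I>. L I)"
  have W: "subspace W" unfolding W_def by (rule subspace_span)
  obtain B where B: "B \<subseteq> (\<Union>I\<in>\<I>. L I)" "independent B" "(\<Union>I\<in>\<I>. L I) \<subseteq> span B"
    using basis_exists[of "\<Union>I\<in>\<I>. L I"] by metis
  have "finite B" using B(2) by (rule independent_imp_finite)
  have "W \<subseteq> span B" unfolding W_def using B(3) by (simp add: span_minimal)
  have BW: "B \<subseteq> W" unfolding W_def using B(1) span_superset by blast
  obtain i where i: "\<And>b. b \<in> B \<Longrightarrow> i b \<in> \<I> \<and> b \<in> L (i b)"
    using B(1) by (metis UN_E subsetD)
  \<comment> \<open>The first summand detects directions inside W and the second those orthogonal to
    W; the second vanishes on W.\<close>
  define T where "T x = (\<Sum>b\<in>B. (x \<bullet> b) *\<^sub>R b) + (x - orth_proj W x)" for x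
  have "linear T"
    using linear_orth_proj[OF W] unfolding T_def
    by (intro linearI)
      (simp_all add: inner_add_left scaleR_add_left sum.distrib linear_add linear_scale
        scaleR_diff_right scaleR_right.sum scaleR_add_right)
  moreover have "x = 0" if "T x = 0" for x
  proof -
    \<comment> \<open>Testing \<open>T x\<close> against x gives a sum of squares, so a kernel
      vector is orthogonal to B and lies in its span.\<close>
    have "(\<Sum>b\<in>B. (x \<bullet> b)\<^sup>2) + (norm (x - orth_proj W x))\<^sup>2 = x \<bullet> T x"
    proof -
      have "(x - orth_proj W x) \<bullet> orth_proj W x = 0"
        using orth_proj[OF W] by (simp add: orthogonal_def)
      then have "(norm (x - orth_proj W x))\<^sup>2 = x \<bullet> (x - orth_proj W x)"
        by (simp add: power2_norm_eq_inner inner_diff_left inner_diff_right inner_commute)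
      then show ?thesis
        by (simp add: T_def inner_add_right inner_sum_right power2_eq_square)
    qed
    with that have "(\<Sum>b\<in>B. (x \<bullet> b)\<^sup>2) + (norm (x - orth_proj W x))\<^sup>2 = 0" by simp
    moreover have "0 \<le> (\<Sum>b\<in>B. (x \<bullet> b)\<^sup>2)" by (intro sum_nonneg) auto
    ultimately have "(\<Sum>b\<in>B. (x \<bullet> b)\<^sup>2) = 0" "x = orth_proj W x"
      by (auto simp: add_nonneg_eq_0_iff)
    then have "\<And>b. b \<in> B \<Longrightarrow> orthogonal x b" "x \<in> span B"
      using \<open>finite B\<close> orth_proj(1)[OF W, of x] \<open>W \<subseteq> span B\<close>
      by (auto simp: sum_nonneg_eq_0_iff orthogonal_def)
    then have "orthogonal x x" using orthogonal_to_span by blast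
    then show ?thesis by (simp add: orthogonal_self)
  qed
  ultimately obtain c where c: "0 < c" "\<And>x. c * norm x \<le> norm (T x)"
    using linear_inj_bounded_below_pos[of T] linear_injective_0[of T] by metis
  define K where "K = (\<Sum>b\<in>B. (norm b)\<^sup>2)"
  have "0 \<le> K" unfolding K_def by (intro sum_nonneg) auto
  have "norm (orth_proj W x) \<le> (K + 1) / c * (\<Sum>I\<in>i ` B. norm (orth_proj (L I) x))" for x
  proof -
    let ?s = "\<Sum>I\<in>i ` B. norm (orth_proj (L I) x)"
    have "orth_proj W (orth_proj W x) = orth_proj W x"
      using orth_proj(1)[OF W] by (intro orth_proj_eqI[OF W]) (auto simp: orthogonal_def)
    then have T: "T (orth_proj W x) = (\<Sum>b\<in>B. (orth_proj W x \<bullet> b) *\<^sub>R b)"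
      by (simp add: T_def)
    have "c * norm (orth_proj W x) \<le> norm (\<Sum>b\<in>B. (orth_proj W x \<bullet> b) *\<^sub>R b)"
      using c(2)[of "orth_proj W x"] unfolding T .
    also have "\<dots> \<le> (\<Sum>b\<in>B. ?s * (norm b)\<^sup>2)"
    proof (rule sum_norm_le)
      fix b assume b: "b \<in> B"
      \<comment> \<open>b lies both in W and in \<open>L (i b)\<close>, so its inner product with x
        can be read off from either projection.\<close>
      have "orth_proj W x \<bullet> b = x \<bullet> b"
        using orth_proj(2)[OF W, of b x] b BW by (auto simp: orthogonal_def inner_diff_left)
      also have "x \<bullet> b = orth_proj (L (i b)) x \<bullet> b"
        using orth_proj(2)[OF sub, of "i b" b x] i[OF b] by (auto simp: orthogonal_def inner_diff_left)
      finally have "\<bar>orth_proj W x \<bullet> b\<bar> \<le> norm (orth_proj (L (i b)) x) * norm b"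
        by (simp add: Cauchy_Schwarz_ineq2)
      also have "\<dots> \<le> ?s * norm b"
        using b \<open>finite B\<close> by (intro mult_right_mono member_le_sum) auto
      finally have "\<bar>orth_proj W x \<bullet> b\<bar> * norm b \<le> ?s * norm b * norm b"
        by (intro mult_right_mono) auto
      then show "norm ((orth_proj W x \<bullet> b) *\<^sub>R b) \<le> ?s * (norm b)\<^sup>2"
        by (simp add: power2_eq_square mult.assoc)
    qed
    also have "\<dots> = K * ?s"
      unfolding K_def sum_distrib_left[symmetric] by (rule mult.commute)
    \<comment> \<open>K vanishes when B is empty; adding 1 keeps the constant positive.\<close>
    also have "\<dots> \<le> (K + 1) * ?s"
      by (intro mult_right_mono sum_nonneg) auto
    finally show ?thesis using c(1) by (simp add: field_simps)
  qed
  moreover have "0 < (K + 1) / c" using \<open>0 \<le> K\<close> c(1) by simp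
  ultimately show ?thesis
    using that[of "i ` B" "(K + 1) / c"] \<open>finite B\<close> i unfolding W_def by blast
qed

text \<open>If the projection onto W is large, so is one of the finitely many projections onto
  \<open>L I\<close> with I in F; each of these has a Chernoff tail.\<close>

lemma (in prob_space) span_noise_tail:
  fixes L :: "'i \<Rightarrow> (real^'n) set"
  assumes sub: "\<And>I. I \<in> F \<Longrightarrow> subspace (L I)" and "finite F" "0 < C" "0 < \<alpha>"
    and meas: "\<xi> \<in> borel_measurable M"
    and int: "\<And>I. I \<in> F \<Longrightarrow> integrable M (\<lambda>\<omega>. exp (\<alpha> * (norm (orth_proj (L I) (\<xi> \<omega>)))\<^sup>2))"
    and ln: "\<And>I. I \<in> F \<Longrightarrow> ln (\<integral>\<omega>. exp (\<alpha> * (norm (orth_proj (L I) (\<xi> \<omega>)))\<^sup>2) \<partial>M) \<le> \<rho> I"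
    and W: "\<And>x. norm (orth_proj W x) \<le> C * (\<Sum>I\<in>F. norm (orth_proj (L I) x))"
    and "0 \<le> x"
  shows "prob {\<omega>\<in>space M. x \<le> (norm (orth_proj W (\<xi> \<omega>)))\<^sup>2}
    \<le> (1 + (\<Sum>I\<in>F. exp (\<rho> I))) * exp (- (\<alpha> / (C * (card F + 1))\<^sup>2 * x))"
\<comment> \<open>At x = 0 the bound is at least 1 and so trivial; a positive x makes the threshold
  t below positive.\<close>
proof (cases "x = 0")
  case True
  have "0 \<le> (\<Sum>I\<in>F. exp (\<rho> I))" by (intro sum_nonneg) auto
  then show ?thesis unfolding True by (simp add: prob_space)
next
  case False
  with \<open>0 \<le> x\<close> have "0 < x" by simp
  define q where "q = \<alpha> / (C * (card F + 1))\<^sup>2 * x"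
  let ?A = "\<lambda>I. {\<omega>\<in>space M. q \<le> \<alpha> * (norm (orth_proj (L I) (\<xi> \<omega>)))\<^sup>2}"
  note tail = orth_proj_tail[OF sub meas \<open>0 < \<alpha>\<close> int ln]
  have "{\<omega>\<in>space M. x \<le> (norm (orth_proj W (\<xi> \<omega>)))\<^sup>2} \<subseteq> (\<Union>I\<in>F. ?A I)"
  proof
    fix \<omega> assume "\<omega> \<in> {\<omega>\<in>space M. x \<le> (norm (orth_proj W (\<xi> \<omega>)))\<^sup>2}"
    then have \<omega>: "\<omega> \<in> space M" "x \<le> (norm (orth_proj W (\<xi> \<omega>)))\<^sup>2" by auto
    \<comment> \<open>With \<open>card F + 1\<close> in place of \<open>card F\<close>, norms all
      below t force their sum strictly below \<open>sqrt x / C\<close>; an empty F is covered as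
      well.\<close>
    define t where "t = sqrt x / (C * (card F + 1))"
    have pos: "0 < C * (real (card F) + 1)" using \<open>0 < C\<close> by (simp add: add_nonneg_pos)
    have "0 < t" unfolding t_def using \<open>0 < x\<close> pos by (simp add: add.commute)
    have "\<exists>I\<in>F. t \<le> norm (orth_proj (L I) (\<xi> \<omega>))"
    proof (rule ccontr)
      assume "\<not> ?thesis"
      then have "(\<Sum>I\<in>F. norm (orth_proj (L I) (\<xi> \<omega>))) \<le> (\<Sum>I\<in>F. t)"
        by (intro sum_mono) auto
      then have "(\<Sum>I\<in>F. norm (orth_proj (L I) (\<xi> \<omega>))) < (card F + 1) * t"
        using \<open>0 < t\<close> by (simp add: algebra_simps)
      then have "C * (\<Sum>I\<in>F. norm (orth_proj (L I) (\<xi> \<omega>))) < C * ((card F + 1) * t)"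
        using \<open>0 < C\<close> by simp
      also have "\<dots> = sqrt x"
        unfolding t_def using pos by (simp add: field_simps)
      finally have "norm (orth_proj W (\<xi> \<omega>)) < sqrt x"
        using W[of "\<xi> \<omega>"] by linarith
      moreover have "sqrt x \<le> norm (orth_proj W (\<xi> \<omega>))"
        using \<omega>(2) by (simp add: real_le_lsqrt)
      ultimately show False by simp
    qed
    then obtain I where I: "I \<in> F" "t \<le> norm (orth_proj (L I) (\<xi> \<omega>))" by blast
    have "\<alpha> * t\<^sup>2 \<le> \<alpha> * (norm (orth_proj (L I) (\<xi> \<omega>)))\<^sup>2"
      using I(2) \<open>0 < t\<close> \<open>0 < \<alpha>\<close> by (intro mult_left_mono power_mono) auto
    moreover have "\<alpha> * t\<^sup>2 = q"
      unfolding t_def q_def using \<open>0 < x\<close> by (simp add: power_divide)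
    ultimately show "\<omega> \<in> (\<Union>I\<in>F. ?A I)" using I(1) \<omega>(1) by auto
  qed
  then have "prob {\<omega>\<in>space M. x \<le> (norm (orth_proj W (\<xi> \<omega>)))\<^sup>2} \<le> prob (\<Union>I\<in>F. ?A I)"
    using tail(1) \<open>finite F\<close> by (intro finite_measure_mono) auto
  also have "\<dots> \<le> (\<Sum>I\<in>F. prob (?A I))"
    using tail(1) \<open>finite F\<close> by (intro finite_measure_subadditive_finite) auto
  also have "\<dots> \<le> (\<Sum>I\<in>F. exp (\<rho> I - q))"
    using tail(2) by (intro sum_mono)
  also have "\<dots> = (\<Sum>I\<in>F. exp (\<rho> I)) * exp (- q)"
    by (simp add: sum_distrib_right exp_diff exp_minus divide_inverse)
  also have "\<dots> \<le> (1 + (\<Sum>I\<in>F. exp (\<rho> I))) * exp (- q)"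
    by (intro mult_right_mono) auto
  finally show ?thesis unfolding q_def .
qed

section \<open>Penalized selection and posterior weights for a fixed observation\<close>

locale structure_selection =
  fixes \<alpha> \<nu> \<kappa> \<sigma> :: real and \<I> :: "'i set" and L :: "'i \<Rightarrow> (real^'n) set"
    and \<rho> :: "'i \<Rightarrow> real" and Ihat :: "real^'n \<Rightarrow> 'i"
  assumes alpha: "0 < \<alpha>" "\<alpha> \<le> 1" and nu: "0 < \<nu>"
    and kappa: "\<kappa> > (32 * \<nu> + 10 + \<alpha>) / (4 * \<alpha>)"
    and sigma: "0 < \<sigma>"
    and subspaces: "I \<in> \<I> \<Longrightarrow> subspace (L I)"
    and rho_nonneg: "I \<in> \<I> \<Longrightarrow> 0 \<le> \<rho> I"
    and summable: "(\<lambda>I. exp (- \<nu> * \<rho> I)) summable_on \<I>"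
    and selector: "selector \<kappa> \<sigma> \<I> L \<rho> Ihat"
begin

lemma alpha_kappa: "\<alpha> * \<kappa> > 8 * \<nu> + 5 / 2 + \<alpha> / 4"
  using kappa alpha by (simp add: field_simps)

text \<open>Because \<alpha> \<le> 1, lower bounds on \<open>\<alpha> * \<kappa>\<close> pass to
  \<kappa>. The bound by \<nu> gives summable weights; the other serves for positivity and for
  \<kappa> \<ge> 1.\<close>

lemma kappa_ge: "\<kappa> > 5 / 2" "\<kappa> > \<nu>"
proof -
  have "\<alpha> * \<kappa> > 5 / 2" "\<alpha> * \<kappa> > \<nu>" using alpha_kappa alpha nu by auto
  moreover from this have "\<kappa> > 0" using alpha nu
    by (metis less_trans zero_less_mult_pos)
  then have "\<alpha> * \<kappa> \<le> \<kappa>" using alpha by simp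
  ultimately show "\<kappa> > 5 / 2" "\<kappa> > \<nu>" by auto
qed

lemma Ihat_in: "Ihat y \<in> \<I>"
  using selector unfolding selector_def is_arg_max_def by blast

abbreviation weight :: "'i \<Rightarrow> real^'n \<Rightarrow> real" where
  "weight I y \<equiv> unnorm_weight \<kappa> \<sigma> L \<rho> I y"

lemma weight_pos: "0 < weight I y"
  by (simp add: unnorm_weight_def)

lemma weight_le: "I \<in> \<I> \<Longrightarrow> weight I y \<le> exp (- \<nu> * \<rho> I)"
proof -
  assume I: "I \<in> \<I>"
  have "weight I y \<le> exp (- \<kappa> * \<rho> I) * 1"
    unfolding unnorm_weight_def by (intro mult_left_mono) auto
  also have "\<dots> \<le> exp (- \<nu> * \<rho> I)"
    using rho_nonneg[OF I] kappa_ge(2) by (simp add: mult_right_mono)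
  finally show ?thesis .
qed

lemma summable_weight: "(\<lambda>I. weight I y) summable_on \<I>"
  by (rule summable_on_comparison_test[OF summable]) (use weight_le in \<open>auto simp: less_imp_le[OF weight_pos]\<close>)

lemma weight_le_total: "I \<in> \<I> \<Longrightarrow> weight I y \<le> (\<Sum>\<^sub>\<infinity>J\<in>\<I>. weight J y)"
  using finite_sum_le_infsum[OF summable_weight, of "{I}" y]
  by (simp add: less_imp_le[OF weight_pos])

lemma total_weight_pos: "0 < (\<Sum>\<^sub>\<infinity>J\<in>\<I>. weight J y)"
  using weight_le_total[OF Ihat_in[of y], of y] weight_pos by (metis less_le_trans)

abbreviation posterior :: "'i \<Rightarrow> real^'n \<Rightarrow> real" where
  "posterior I y \<equiv> pi_tilde \<kappa> \<sigma> \<I> L \<rho> I y"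

lemma posterior_nonneg: "0 \<le> posterior I y"
  unfolding pi_tilde_def using total_weight_pos weight_pos by (simp add: less_imp_le)

lemma posterior_summable: "(\<lambda>I. posterior I y) summable_on \<I>"
  unfolding pi_tilde_def divide_inverse by (intro summable_on_cmult_left summable_weight)

lemma posterior_sum: "(\<Sum>\<^sub>\<infinity>I\<in>\<I>. posterior I y) = 1"
  unfolding pi_tilde_def divide_inverse
  using total_weight_pos[of y] by (simp add: infsum_cmult_left' )

text \<open>Keeping a single term of the normalizing sum removes the infinite sum from the
  comparison of structures.\<close>

lemma posterior_le_ratio: "J \<in> \<I> \<Longrightarrow> posterior I y \<le> weight I y / weight J y"
  unfolding pi_tilde_def
  using weight_le_total[of J y] weight_pos
  by (intro divide_left_mono) (auto intro!: mult_pos_pos total_weight_pos simp: less_imp_le)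

lemma weight_ratio:
  "weight I y / weight J y
    = exp (\<kappa> * (\<rho> J - \<rho> I) + (sqdist (L J) y - sqdist (L I) y) / (2 * \<sigma>\<^sup>2))"
  unfolding unnorm_weight_def
  by (simp add: exp_add[symmetric] exp_diff[symmetric] diff_divide_distrib algebra_simps)

lemma selected_le:
  assumes J: "J \<in> \<I>"
  shows "weight J y \<le> weight (Ihat y) y"
proof -
  have "\<not> posterior (Ihat y) y < posterior J y"
    using selector J unfolding selector_def is_arg_max_def by blast
  then show ?thesis
    unfolding pi_tilde_def using total_weight_pos[of y] by (simp add: divide_less_cancel)
qed

text \<open>This is the logarithm of \<open>selected_le\<close>: maximizing the weight means
  minimizing the penalized residual.\<close>

lemma selected_penalized:
  assumes J: "J \<in> \<I>"
  shows "sqdist (L (Ihat y)) y + 2 * \<kappa> * \<sigma>\<^sup>2 * \<rho> (Ihat y)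
    \<le> sqdist (L J) y + 2 * \<kappa> * \<sigma>\<^sup>2 * \<rho> J"
proof -
  have "1 \<le> weight (Ihat y) y / weight J y"
    using selected_le[OF J, of y] weight_pos by simp
  then have "0 \<le> \<kappa> * (\<rho> J - \<rho> (Ihat y))
      + (sqdist (L J) y - sqdist (L (Ihat y)) y) / (2 * \<sigma>\<^sup>2)"
    unfolding weight_ratio by simp
  then show ?thesis using sigma by (simp add: field_simps)
qed

text \<open>W contains every structure, so it takes the place of the upper bound that (A3) would
  provide, and the noise term is the same whichever structure is selected.\<close>

lemma selected_complexity_span:
  assumes W: "subspace W" "\<And>I. I \<in> \<I> \<Longrightarrow> L I \<subseteq> W" and I0: "I0 \<in> \<I>"
  shows "\<sigma>\<^sup>2 * \<rho> (Ihat (\<theta> + \<sigma> *\<^sub>R \<xi>))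
    \<le> r2 \<sigma> L \<rho> I0 \<theta> + \<sigma>\<^sup>2 * (norm (orth_proj W \<xi>))\<^sup>2"
proof -
  let ?y = "\<theta> + \<sigma> *\<^sub>R \<xi>"
  let ?Z = "(norm (orth_proj W \<xi>))\<^sup>2"
  define I where "I = Ihat ?y"
  have I: "I \<in> \<I>" unfolding I_def by (rule Ihat_in)
  have "sqdist (L I0) ?y - sqdist W ?y \<le> 2 * (sqdist (L I0) \<theta> - sqdist W \<theta>) + 2 * (\<sigma>\<^sup>2 * ?Z)"
    using sqdist_gap_perturb[OF subspaces[OF I0] W(1) W(2)[OF I0], of 1 \<theta> \<sigma> \<xi>] by simp
  moreover have "sqdist W ?y \<le> sqdist (L I) ?y"
    by (rule sqdist_mono[OF subspaces[OF I] W(1) W(2)[OF I]])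
  moreover have "0 \<le> sqdist W \<theta>" by simp
  moreover have "sqdist (L I) ?y + 2 * (\<kappa> * (\<sigma>\<^sup>2 * \<rho> I))
      \<le> sqdist (L I0) ?y + 2 * (\<kappa> * (\<sigma>\<^sup>2 * \<rho> I0))"
    using selected_penalized[OF I0, of ?y] unfolding I_def by (simp only: mult.assoc)
  ultimately have "\<kappa> * (\<sigma>\<^sup>2 * \<rho> I) \<le> \<kappa> * (\<sigma>\<^sup>2 * \<rho> I0) + (sqdist (L I0) \<theta> + \<sigma>\<^sup>2 * ?Z)"
    by argo
  \<comment> \<open>\<kappa> \<ge> 1 lets the bias and the noise carry the factor \<kappa> too,
    which then cancels.\<close>
  also have "\<dots> \<le> \<kappa> * (\<sigma>\<^sup>2 * \<rho> I0) + \<kappa> * (sqdist (L I0) \<theta> + \<sigma>\<^sup>2 * ?Z)"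
    using kappa_ge mult_right_mono[of 1 \<kappa> "sqdist (L I0) \<theta> + \<sigma>\<^sup>2 * ?Z"] by simp
  finally have "\<kappa> * (\<sigma>\<^sup>2 * \<rho> I) \<le> \<kappa> * (r2 \<sigma> L \<rho> I0 \<theta> + \<sigma>\<^sup>2 * ?Z)"
    unfolding r2_def by (simp add: algebra_simps)
  then show ?thesis unfolding I_def[symmetric] using kappa_ge by simp
qed

end

section \<open>Deterministic bounds on the good noise event\<close>

text \<open>A single realization: \<theta> and \<xi> are fixed vectors. The reference
  \<open>I0\<close> is left open, as it is the oracle for the radius bound and the
  \<open>\<tau>0\<close>-oracle for coverage.\<close>

locale noise_control = structure_selection \<alpha> \<nu> \<kappa> \<sigma> \<I> L \<rho> Ihat
  for \<alpha> \<nu> \<kappa> \<sigma> and \<I> :: "'i set" and L :: "'i \<Rightarrow> (real^'n) set" and \<rho> Ihat +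
  fixes \<theta> \<xi> :: "real^'n" and I0 :: 'i and S :: "'i \<Rightarrow> 'i" and m :: real
  assumes I0: "I0 \<in> \<I>"
    and S: "I \<in> \<I> \<Longrightarrow> S I \<in> \<I>" "I \<in> \<I> \<Longrightarrow> L I \<subseteq> L (S I)" "I \<in> \<I> \<Longrightarrow> L I0 \<subseteq> L (S I)"
      "I \<in> \<I> \<Longrightarrow> \<rho> (S I) \<le> \<rho> I + \<rho> I0"
    and m: "0 \<le> m"
    and noise: "I \<in> \<I> \<Longrightarrow>
      \<alpha> * (norm (orth_proj (L (S I)) \<xi>))\<^sup>2 < (1 + \<nu>) * \<rho> I + \<rho> I0 + m"
begin

abbreviation Z :: "'i \<Rightarrow> real" where
  "Z I \<equiv> (norm (orth_proj (L (S I)) \<xi>))\<^sup>2"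

abbreviation y :: "real^'n" where
  "y \<equiv> \<theta> + \<sigma> *\<^sub>R \<xi>"

text \<open>The perturbation bound in both directions: from \<theta> to y by adding the noise, and
  back from y to \<theta> with the factor \<open>- \<sigma>\<close>.\<close>

lemma sqdist_gap_obs:
  assumes "I \<in> \<I>" "J \<in> \<I>" "L J \<subseteq> L (S I)" "0 < c"
  shows "sqdist (L J) y - sqdist (L (S I)) y
      \<le> (1 + c) * (sqdist (L J) \<theta> - sqdist (L (S I)) \<theta>) + (1 + 1 / c) * (\<sigma>\<^sup>2 * Z I)"
    and "sqdist (L J) \<theta> - sqdist (L (S I)) \<theta>
      \<le> (1 + c) * (sqdist (L J) y - sqdist (L (S I)) y) + (1 + 1 / c) * (\<sigma>\<^sup>2 * Z I)"
  using sqdist_gap_perturb[of "L J" "L (S I)" c \<theta> \<sigma> \<xi>]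
    sqdist_gap_perturb[of "L J" "L (S I)" c y "- \<sigma>" \<xi>] assms S(1) subspaces
  by auto

lemma sqdist_sup_le:
  assumes "I \<in> \<I>"
  shows "sqdist (L (S I)) x \<le> sqdist (L I) x" "sqdist (L (S I)) x \<le> sqdist (L I0) x"
  using sqdist_mono assms S I0 subspaces by metis+

text \<open>
  The oracle property, applied to the larger space \<open>L (S I)\<close>, bounds the bias that \<open>L I\<close> can remove
  by \<open>\<sigma>\<^sup>2 * \<rho> I\<close>, so the bias of the oracle does not enter.
\<close>

lemma selected_complexity_upper:
  assumes minimal: "\<And>J. J \<in> \<I> \<Longrightarrow> sqdist (L I0) \<theta> + \<sigma>\<^sup>2 * \<rho> I0 \<le> sqdist (L J) \<theta> + \<sigma>\<^sup>2 * \<rho> J"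
  shows "3 / 4 * \<rho> (Ihat y) < (\<alpha> * \<kappa> + 1) * \<rho> I0 + m"
proof -
  define I where "I = Ihat y"
  have I: "I \<in> \<I>" unfolding I_def by (rule Ihat_in)
  have "sqdist (L I0) \<theta> - sqdist (L (S I)) \<theta> \<le> \<sigma>\<^sup>2 * (\<rho> (S I) - \<rho> I0)"
    using minimal[OF S(1)[OF I]] by (simp add: algebra_simps)
  also have "\<dots> \<le> \<sigma>\<^sup>2 * \<rho> I"
    using S(4)[OF I] by (intro mult_left_mono) auto
  finally have "sqdist (L I0) \<theta> - sqdist (L (S I)) \<theta> \<le> \<sigma>\<^sup>2 * \<rho> I" .
  moreover have "sqdist (L I) y + 2 * \<kappa> * \<sigma>\<^sup>2 * \<rho> I \<le> sqdist (L I0) y + 2 * \<kappa> * \<sigma>\<^sup>2 * \<rho> I0"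
    unfolding I_def by (rule selected_penalized[OF I0])
  ultimately have "\<sigma>\<^sup>2 * (\<kappa> * (\<rho> I - \<rho> I0)) \<le> \<sigma>\<^sup>2 * (\<rho> I + Z I)"
    using sqdist_gap_obs(1)[OF I I0 S(3)[OF I], of 1] sqdist_sup_le(1)[OF I, of y]
    by (simp add: algebra_simps del: power_mono_iff)
  then have "\<kappa> * (\<rho> I - \<rho> I0) \<le> \<rho> I + Z I"
    using sigma by simp
  then have "\<alpha> * (\<kappa> * (\<rho> I - \<rho> I0)) \<le> \<alpha> * (\<rho> I + Z I)"
    using alpha by (intro mult_left_mono) auto
  with noise[OF I] have "(\<alpha> * \<kappa> - \<alpha> - 1 - \<nu>) * \<rho> I < (\<alpha> * \<kappa> + 1) * \<rho> I0 + m"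
    by (simp add: algebra_simps)
  \<comment> \<open>By \<open>alpha_kappa\<close> the factor is at least
    \<open>7 * \<nu> + 3 / 2 - 3 / 4 * \<alpha>\<close>, and \<alpha> \<le> 1.\<close>
  moreover have "3 / 4 * \<rho> I \<le> (\<alpha> * \<kappa> - \<alpha> - 1 - \<nu>) * \<rho> I"
    using alpha_kappa alpha nu rho_nonneg[OF I] by (intro mult_right_mono) auto
  ultimately show ?thesis unfolding I_def by linarith
qed

text \<open>
  Comparing the selected structure with \<open>S (Ihat y)\<close> instead of \<open>I0\<close> keeps the noise orthogonal to
  \<open>L I0\<close> out of the comparison; with Young's inequality for the weights 3/2 and 3 this is
  what the constant \<open>3 * (1 + \<kappa> * \<alpha>) / \<alpha>\<close> allows.
\<close>

lemma selected_complexity_lower: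
  assumes delta: "0 < \<delta>" "\<delta> < 1"
    and tau: "\<tau>0 > (1 + \<delta>) / (1 - \<delta>) * (3 * (1 + \<kappa> * \<alpha>) / \<alpha>)"
    and minimal: "\<And>J. J \<in> \<I> \<Longrightarrow>
      sqdist (L I0) \<theta> + \<tau>0 * \<sigma>\<^sup>2 * \<rho> I0 \<le> sqdist (L J) \<theta> + \<tau>0 * \<sigma>\<^sup>2 * \<rho> J"
  shows "\<delta> * \<rho> I0 < \<rho> (Ihat y) \<or> 2 * \<delta> * \<rho> I0 \<le> m"
proof (rule disjCI)
  define I where "I = Ihat y"
  assume "\<not> 2 * \<delta> * \<rho> I0 \<le> m"
  then have large: "m < 2 * \<delta> * \<rho> I0" by simp
  show "\<delta> * \<rho> I0 < \<rho> (Ihat y)"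
  proof (rule ccontr)
    assume "\<not> \<delta> * \<rho> I0 < \<rho> (Ihat y)"
    then have small: "\<rho> I \<le> \<delta> * \<rho> I0" by (simp add: I_def)
    have I: "I \<in> \<I>" unfolding I_def by (rule Ihat_in)
    have rho0: "0 \<le> \<rho> I0" using rho_nonneg I0 by blast
    have ak: "\<alpha> * \<kappa> > \<nu> + 2" "\<alpha> * \<kappa> > 0" using alpha_kappa alpha nu by auto
    have tau': "\<alpha> * \<tau>0 * (1 - \<delta>) > 3 * (1 + \<delta>) * (1 + \<alpha> * \<kappa>)"
      using tau alpha delta by (simp add: field_simps)
    have "0 < \<tau>0"
    proof -
      have "0 < (1 + \<delta>) / (1 - \<delta>) * (3 * (1 + \<kappa> * \<alpha>) / \<alpha>)"
        using delta alpha ak by (simp add: mult.commute add_pos_pos)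
      then show ?thesis using tau by linarith
    qed
    have "sqdist (L I) y + 2 * \<kappa> * \<sigma>\<^sup>2 * \<rho> I \<le> sqdist (L (S I)) y + 2 * \<kappa> * \<sigma>\<^sup>2 * \<rho> (S I)"
      unfolding I_def by (rule selected_penalized[OF S(1)[OF Ihat_in]])
    moreover have "2 * \<kappa> * \<sigma>\<^sup>2 * \<rho> (S I) \<le> 2 * \<kappa> * \<sigma>\<^sup>2 * (\<rho> I + \<rho> I0)"
      using S(4)[OF I] kappa_ge by (intro mult_left_mono) auto
    ultimately have "sqdist (L I) y - sqdist (L (S I)) y \<le> 2 * \<kappa> * \<sigma>\<^sup>2 * \<rho> I0"
      by (simp add: algebra_simps)
    then have "sqdist (L I) \<theta> - sqdist (L I0) \<theta> \<le> 3 * \<kappa> * \<sigma>\<^sup>2 * \<rho> I0 + 3 * (\<sigma>\<^sup>2 * Z I)"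
      using sqdist_gap_obs(2)[OF I I S(2)[OF I], of "1 / 2"] sqdist_sup_le(2)[OF I, of \<theta>]
      by (simp add: field_simps del: power_mono_iff)
    with minimal[OF I] have "\<sigma>\<^sup>2 * (\<tau>0 * (\<rho> I0 - \<rho> I)) \<le> \<sigma>\<^sup>2 * (3 * \<kappa> * \<rho> I0 + 3 * Z I)"
      by (simp add: algebra_simps)
    then have "\<tau>0 * (\<rho> I0 - \<rho> I) \<le> 3 * \<kappa> * \<rho> I0 + 3 * Z I"
      using sigma by simp
    then have "\<alpha> * (\<tau>0 * (\<rho> I0 - \<rho> I)) \<le> \<alpha> * (3 * \<kappa> * \<rho> I0 + 3 * Z I)"
      using alpha by (intro mult_left_mono) auto
    also have "\<dots> \<le> 3 * (\<alpha> * \<kappa>) * \<rho> I0 + 3 * ((1 + \<nu>) * \<rho> I + \<rho> I0 + m)"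
      using noise[OF I] by (simp add: algebra_simps)
    also have "\<dots> \<le> 3 * (\<alpha> * \<kappa>) * \<rho> I0 + 3 * ((1 + \<nu>) * (\<delta> * \<rho> I0) + \<rho> I0 + m)"
      using small nu ak(2) by (intro add_mono mult_left_mono) auto
    finally have upper: "\<alpha> * (\<tau>0 * (\<rho> I0 - \<rho> I))
      \<le> 3 * (\<alpha> * \<kappa>) * \<rho> I0 + 3 * ((1 + \<nu>) * (\<delta> * \<rho> I0) + \<rho> I0 + m)" .
    have "3 * (1 + \<delta>) * (1 + \<alpha> * \<kappa>) * \<rho> I0 \<le> \<alpha> * \<tau>0 * (1 - \<delta>) * \<rho> I0"
      using tau' rho0 by (intro mult_right_mono) auto
    also have "\<dots> = (\<alpha> * \<tau>0) * (\<rho> I0 - \<delta> * \<rho> I0)" by (simp add: algebra_simps)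
    also have "\<dots> \<le> (\<alpha> * \<tau>0) * (\<rho> I0 - \<rho> I)"
      using small alpha \<open>0 < \<tau>0\<close> by (intro mult_left_mono) auto
    \<comment> \<open>In the expansion of
      \<open>3 * (1 + \<delta>) * (1 + \<alpha> * \<kappa>) * \<rho> I0\<close> the terms without
      \<delta> cancel against the upper bound, as does \<open>3 * \<delta> * \<rho> I0\<close>; the
      rest is divided by 3.\<close>
    finally have "(\<alpha> * \<kappa> - \<nu>) * (\<delta> * \<rho> I0) \<le> m"
      using upper by (simp add: algebra_simps)
    \<comment> \<open>\<open>\<alpha> * \<kappa> > \<nu> + 2\<close> yields the factor 2 of the
      second alternative.\<close>
    moreover have "2 * (\<delta> * \<rho> I0) \<le> (\<alpha> * \<kappa> - \<nu>) * (\<delta> * \<rho> I0)"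
      using ak delta rho0 by (intro mult_right_mono) auto
    ultimately show False using large by simp
  qed
qed

section \<open>Risk of the two estimators on the good event\<close>

definition risk_level :: real where
  "risk_level = \<kappa> * \<rho> I0 + 5 / 4 * (sqdist (L I0) \<theta> / \<sigma>\<^sup>2) + 3 / 2 * ((\<rho> I0 + m) / \<alpha>)"

text \<open>The logarithm of the weight of I relative to \<open>I0\<close> will be at most
  \<open>risk_level - excess I\<close>: the first term collects what belongs to \<open>I0\<close>
  and m, the second the bias and complexity of I. The coefficient
  \<open>(1 + 4 * \<nu>) / \<alpha>\<close> is at least \<open>4 * \<nu>\<close>, for summability,
  and small enough that \<kappa> pays for it and for the noise.\<close>

definition excess :: "'i \<Rightarrow> real" where
  "excess I = sqdist (L I) \<theta> / (4 * \<sigma>\<^sup>2) + (1 + 4 * \<nu>) / \<alpha> * \<rho> I"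

lemma risk_level_ge: "(\<rho> I0 + m) / \<alpha> \<le> risk_level"
proof -
  have "0 \<le> (\<rho> I0 + m) / \<alpha>" "0 \<le> \<kappa> * \<rho> I0" "0 \<le> sqdist (L I0) \<theta> / \<sigma>\<^sup>2"
    using rho_nonneg[OF I0] m alpha kappa_ge by auto
  then show ?thesis unfolding risk_level_def by linarith
qed

lemma risk_level_nonneg: "0 \<le> risk_level"
proof -
  have "0 \<le> (\<rho> I0 + m) / \<alpha>" using rho_nonneg[OF I0] m alpha by simp
  then show ?thesis using risk_level_ge by linarith
qed

lemma noise_le:
  assumes "I \<in> \<I>"
  shows "Z I \<le> (1 + \<nu>) / \<alpha> * \<rho> I + (\<rho> I0 + m) / \<alpha>"
proof -
  have "Z I \<le> ((1 + \<nu>) * \<rho> I + (\<rho> I0 + m)) / \<alpha>"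
    using noise[OF assms] alpha by (simp add: pos_le_divide_eq mult.commute)
  also have "\<dots> = (1 + \<nu>) / \<alpha> * \<rho> I + (\<rho> I0 + m) / \<alpha>"
    by (simp only: add_divide_distrib[of "(1 + \<nu>) * \<rho> I"] times_divide_eq_left)
  finally show ?thesis .
qed

text \<open>\<open>L I0\<close> and \<open>L I\<close> need not be nested, so both residuals are
  compared through \<open>L (S I)\<close>: forward for \<open>I0\<close> and backward for I. Hence
  only the noise \<open>Z I\<close> enters, and \<kappa> absorbs its part proportional to
  \<open>\<rho> I\<close>.\<close>

lemma weight_ratio_le:
  assumes I: "I \<in> \<I>"
  shows "weight I y / weight I0 y \<le> exp (risk_level - excess I)"
proof -
  have "sqdist (L I0) y - sqdist (L I) y
      \<le> 5 / 2 * sqdist (L I0) \<theta> - sqdist (L I) \<theta> / 2 + 3 * (\<sigma>\<^sup>2 * Z I)"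
  proof -
    have "sqdist (L I0) y - sqdist (L (S I)) y
        \<le> 2 * (sqdist (L I0) \<theta> - sqdist (L (S I)) \<theta>) + 2 * (\<sigma>\<^sup>2 * Z I)"
      "sqdist (L I) \<theta> - sqdist (L (S I)) \<theta>
        \<le> 2 * (sqdist (L I) y - sqdist (L (S I)) y) + 2 * (\<sigma>\<^sup>2 * Z I)"
      using sqdist_gap_obs(1)[OF I I0 S(3)[OF I], of 1] sqdist_gap_obs(2)[OF I I S(2)[OF I], of 1]
      by simp_all
    \<comment> \<open>The residual at \<open>L (S I)\<close> has the total factor -3/2 and is
      dropped; at \<open>I0\<close> the factor 2 is rounded up to 5/2.\<close>
    moreover have "0 \<le> sqdist (L (S I)) \<theta>" "0 \<le> sqdist (L I0) \<theta>" by simp_all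
    ultimately show ?thesis by argo
  qed
  then have "(sqdist (L I0) y - sqdist (L I) y) / (2 * \<sigma>\<^sup>2)
      \<le> (5 / 2 * sqdist (L I0) \<theta> - sqdist (L I) \<theta> / 2 + 3 * (\<sigma>\<^sup>2 * Z I)) / (2 * \<sigma>\<^sup>2)"
    using sigma by (intro divide_right_mono) auto
  also have "\<dots> = 5 / 4 * (sqdist (L I0) \<theta> / \<sigma>\<^sup>2) - sqdist (L I) \<theta> / (4 * \<sigma>\<^sup>2) + 3 / 2 * Z I"
    using sigma by (simp add: field_simps)
  also have "\<dots> \<le> 5 / 4 * (sqdist (L I0) \<theta> / \<sigma>\<^sup>2) - sqdist (L I) \<theta> / (4 * \<sigma>\<^sup>2)
      + 3 / 2 * ((1 + \<nu>) / \<alpha> * \<rho> I + (\<rho> I0 + m) / \<alpha>)"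
    by (intro add_left_mono mult_left_mono noise_le[OF I]) auto
  finally have "(sqdist (L I0) y - sqdist (L I) y) / (2 * \<sigma>\<^sup>2) \<le> \<dots>" .
  moreover have "(3 / 2 * ((1 + \<nu>) / \<alpha>) + (1 + 4 * \<nu>) / \<alpha>) * \<rho> I \<le> \<kappa> * \<rho> I"
  proof (rule mult_right_mono)
    have "3 / 2 * ((1 + \<nu>) / \<alpha>) + (1 + 4 * \<nu>) / \<alpha> = (5 / 2 + 11 / 2 * \<nu>) / \<alpha>"
      using alpha by (simp add: field_simps)
    also have "\<dots> \<le> \<kappa>"
      using alpha_kappa alpha nu by (simp add: pos_divide_le_eq mult.commute)
    finally show "3 / 2 * ((1 + \<nu>) / \<alpha>) + (1 + 4 * \<nu>) / \<alpha> \<le> \<kappa>" .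
  qed (rule rho_nonneg[OF I])
  ultimately have "\<kappa> * (\<rho> I0 - \<rho> I) + (sqdist (L I0) y - sqdist (L I) y) / (2 * \<sigma>\<^sup>2)
      \<le> risk_level - excess I"
    unfolding risk_level_def excess_def by (simp add: algebra_simps)
  then show ?thesis unfolding weight_ratio by simp
qed

text \<open>The bias is \<open>4 * \<sigma>\<^sup>2\<close> times the first term of the excess. The
  noise in \<open>L I\<close> is at most \<open>Z I\<close>, whose part in \<open>\<rho> I\<close>
  is covered by the second term.\<close>

lemma projection_error_le:
  assumes I: "I \<in> \<I>"
  shows "(norm (\<theta> - orth_proj (L I) y))\<^sup>2 \<le> \<sigma>\<^sup>2 * (risk_level + 4 * excess I)"
proof -
  have "(norm (orth_proj (L I) \<xi>))\<^sup>2 \<le> Z I"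
    using norm_orth_proj_diff[of "L I" "L (S I)" \<xi>] subspaces S I by simp
  also have "\<dots> \<le> (1 + \<nu>) / \<alpha> * \<rho> I + risk_level"
    using noise_le[OF I] risk_level_ge by linarith
  also have "(1 + \<nu>) / \<alpha> * \<rho> I \<le> 4 * ((1 + 4 * \<nu>) / \<alpha>) * \<rho> I"
    using alpha nu rho_nonneg[OF I] by (intro mult_right_mono) (auto simp: field_simps)
  finally have "\<sigma>\<^sup>2 * (norm (orth_proj (L I) \<xi>))\<^sup>2
      \<le> \<sigma>\<^sup>2 * (4 * ((1 + 4 * \<nu>) / \<alpha>) * \<rho> I + risk_level)"
    by (intro mult_left_mono) auto
  moreover have "sqdist (L I) \<theta> = \<sigma>\<^sup>2 * (4 * (sqdist (L I) \<theta> / (4 * \<sigma>\<^sup>2)))"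
    using sigma by simp
  ultimately show ?thesis
    unfolding orth_proj_estimation_error[OF subspaces[OF I]] excess_def
    by (simp add: algebra_simps)
qed

text \<open>The selected weight is at least that of \<open>I0\<close>, so the selected excess is at
  most \<open>risk_level\<close>; this gives 1 + 4 = 5.\<close>

lemma theta_check_error:
  "(norm (\<theta> - theta_check L Ihat y))\<^sup>2 \<le> \<sigma>\<^sup>2 * (5 * risk_level)"
proof -
  have "1 \<le> weight (Ihat y) y / weight I0 y"
    using selected_le[OF I0, of y] weight_pos by simp
  then have "1 \<le> exp (risk_level - excess (Ihat y))"
    using weight_ratio_le[OF Ihat_in] by (rule order_trans)
  then have "\<sigma>\<^sup>2 * (risk_level + 4 * excess (Ihat y)) \<le> \<sigma>\<^sup>2 * (5 * risk_level)"
    by (intro mult_left_mono) auto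
  then show ?thesis
    unfolding theta_check_def using projection_error_le[OF Ihat_in[of y]] by linarith
qed

text \<open>Either the excess is at most twice the risk level, or the posterior weight is
  exponentially small in it. In the second case one quarter of the excess in the exponent absorbs
  the factor, and another quarter dominates \<open>\<nu> * \<rho> I\<close>, so that the bound is
  summable over I.\<close>

lemma posterior_excess_le:
  assumes I: "I \<in> \<I>"
  shows "posterior I y * excess I \<le> 2 * risk_level * posterior I y + 4 * exp (- \<nu> * \<rho> I)"
proof (cases "excess I \<le> 2 * risk_level")
  case True
  then have "posterior I y * excess I \<le> posterior I y * (2 * risk_level)"
    by (intro mult_left_mono posterior_nonneg)
  then show ?thesis by (simp add: mult_ac add_increasing2)
next
  case False
  define e where "e = excess I"
  have "\<nu> * \<rho> I \<le> e / 4"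
  proof -
    have "4 * \<nu> \<le> (1 + 4 * \<nu>) / \<alpha>"
    proof -
      have "4 * \<nu> * \<alpha> \<le> 4 * \<nu>" using alpha nu by simp
      then show ?thesis using alpha by (simp add: field_simps)
    qed
    then have "4 * (\<nu> * \<rho> I) \<le> (1 + 4 * \<nu>) / \<alpha> * \<rho> I"
      using mult_right_mono[OF _ rho_nonneg[OF I]] by (simp only: mult.assoc[symmetric])
    moreover have "0 \<le> sqdist (L I) \<theta> / (4 * \<sigma>\<^sup>2)" by simp
    ultimately have "4 * (\<nu> * \<rho> I) \<le> e"
      unfolding e_def excess_def by (rule add_increasing[rotated])
    then show ?thesis by simp
  qed
  have e_nonneg: "0 \<le> e" using False risk_level_nonneg unfolding e_def by linarith
  have "posterior I y \<le> exp (risk_level - e)"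
    using posterior_le_ratio[OF I0] weight_ratio_le[OF I] unfolding e_def by (rule order_trans)
  also have "\<dots> \<le> exp (- (e / 4) - e / 4)"
    using False unfolding e_def by simp
  finally have "posterior I y \<le> exp (- (e / 4) - e / 4)" .
  moreover have "e \<le> 4 * exp (e / 4)"
    using exp_ge_add_one_self[of "e / 4"] by linarith
  ultimately have "posterior I y * e \<le> exp (- (e / 4) - e / 4) * (4 * exp (e / 4))"
    using e_nonneg by (intro mult_mono) auto
  also have "\<dots> = 4 * exp (- (e / 4))"
    by (simp add: exp_add[symmetric])
  also have "\<dots> \<le> 4 * exp (- \<nu> * \<rho> I)"
    using \<open>\<nu> * \<rho> I \<le> e / 4\<close> by simp
  finally show ?thesis
    using risk_level_nonneg posterior_nonneg[of I y] unfolding e_def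
    by (simp add: add_increasing)
qed

text \<open>With u the error, \<open>(norm u)\<^sup>2\<close> is the posterior average of
  \<open>u \<bullet> (\<theta> - ?q I)\<close>. Young's inequality bounds it by half of
  \<open>(norm u)\<^sup>2\<close>, to be absorbed on the left, plus half the averaged squared error,
  which \<open>posterior_excess_le\<close> controls.\<close>

lemma theta_tilde_error:
  "(norm (\<theta> - theta_tilde \<kappa> \<sigma> \<I> L \<rho> y))\<^sup>2
    \<le> \<sigma>\<^sup>2 * (9 * risk_level + 16 * (\<Sum>\<^sub>\<infinity>I\<in>\<I>. exp (- \<nu> * \<rho> I)))"
proof -
  let ?p = "\<lambda>I. posterior I y" and ?q = "\<lambda>I. orth_proj (L I) y"
  define u where "u = \<theta> - theta_tilde \<kappa> \<sigma> \<I> L \<rho> y"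
  \<comment> \<open>Projections do not increase norms, so the posterior weights dominate the
    series.\<close>
  have "(\<lambda>I. norm (?p I *\<^sub>R ?q I)) summable_on \<I>"
  proof (rule Infinite_Sum.abs_summable_on_comparison_test')
    show "(\<lambda>I. ?p I * norm y) summable_on \<I>"
      by (rule summable_on_cmult_left[OF posterior_summable])
    show "norm (?p I *\<^sub>R ?q I) \<le> ?p I * norm y" if "I \<in> \<I>" for I
      using norm_orth_proj_le[OF subspaces[OF that], of y] posterior_nonneg[of I y]
      by (simp add: mult_left_mono)
  qed
  then have "((\<lambda>I. ?p I *\<^sub>R ?q I) has_sum theta_tilde \<kappa> \<sigma> \<I> L \<rho> y) \<I>"
    unfolding theta_tilde_def by (rule has_sum_infsum[OF Infinite_Sum.abs_summable_summable])
  then have "((\<lambda>I. u \<bullet> (?p I *\<^sub>R ?q I)) has_sum (u \<bullet> theta_tilde \<kappa> \<sigma> \<I> L \<rho> y)) \<I>"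
    by (rule has_sum_bounded_linear[OF bounded_linear_inner_right[of u]])
  from has_sum_cmult_right[OF this, of "-1"]
  have tilde_sum: "((\<lambda>I. -1 * (u \<bullet> (?p I *\<^sub>R ?q I)))
      has_sum (-1 * (u \<bullet> theta_tilde \<kappa> \<sigma> \<I> L \<rho> y))) \<I>" .
  have p_sum: "(?p has_sum 1) \<I>"
    using has_sum_infsum[OF posterior_summable, of y] unfolding posterior_sum .
  have "((\<lambda>I. ?p I * (u \<bullet> \<theta>) + -1 * (u \<bullet> (?p I *\<^sub>R ?q I)))
      has_sum (1 * (u \<bullet> \<theta>) + -1 * (u \<bullet> theta_tilde \<kappa> \<sigma> \<I> L \<rho> y))) \<I>"
    by (rule has_sum_add[OF has_sum_cmult_left[OF p_sum] tilde_sum])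
  moreover have "1 * (u \<bullet> \<theta>) + -1 * (u \<bullet> theta_tilde \<kappa> \<sigma> \<I> L \<rho> y) = (norm u)\<^sup>2"
    by (simp add: power2_norm_eq_inner u_def inner_diff_right)
  moreover have "?p I * (u \<bullet> \<theta>) + -1 * (u \<bullet> (?p I *\<^sub>R ?q I)) = ?p I * (u \<bullet> (\<theta> - ?q I))" for I
    by (simp add: inner_diff_right right_diff_distrib)
  ultimately have "((\<lambda>I. ?p I * (u \<bullet> (\<theta> - ?q I))) has_sum (norm u)\<^sup>2) \<I>"
    by simp
  \<comment> \<open>1/2 + 2 * 2 = 9/2 is the factor of the risk level and 2 * 4 = 8 that of the
    exponentials; absorbing the half of \<open>(norm u)\<^sup>2\<close> doubles both.\<close>
  moreover have "((\<lambda>I. ?p I * ((norm u)\<^sup>2 / 2 + 9 / 2 * (\<sigma>\<^sup>2 * risk_level))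
        + 8 * \<sigma>\<^sup>2 * exp (- \<nu> * \<rho> I))
      has_sum (1 * ((norm u)\<^sup>2 / 2 + 9 / 2 * (\<sigma>\<^sup>2 * risk_level))
        + 8 * \<sigma>\<^sup>2 * (\<Sum>\<^sub>\<infinity>I\<in>\<I>. exp (- \<nu> * \<rho> I)))) \<I>"
    by (rule has_sum_add[OF has_sum_cmult_left[OF p_sum]
          has_sum_cmult_right[OF has_sum_infsum[OF summable]]])
  moreover have "?p I * (u \<bullet> (\<theta> - ?q I))
      \<le> ?p I * ((norm u)\<^sup>2 / 2 + 9 / 2 * (\<sigma>\<^sup>2 * risk_level)) + 8 * \<sigma>\<^sup>2 * exp (- \<nu> * \<rho> I)"
    if I: "I \<in> \<I>" for I
  proof -
    have "u \<bullet> v \<le> (norm u)\<^sup>2 / 2 + (norm v)\<^sup>2 / 2" for v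
      using zero_le_power2[of "norm (u - v)"] unfolding power2_norm_eq_inner
      by (simp add: inner_diff_left inner_diff_right inner_commute[of v u])
    from this[of "\<theta> - ?q I"]
    have "u \<bullet> (\<theta> - ?q I) \<le> (norm u)\<^sup>2 / 2 + (norm (\<theta> - ?q I))\<^sup>2 / 2" .
    also have "\<dots> \<le> (norm u)\<^sup>2 / 2 + \<sigma>\<^sup>2 * (risk_level + 4 * excess I) / 2"
      using projection_error_le[OF I] by simp
    finally have "?p I * (u \<bullet> (\<theta> - ?q I))
        \<le> ?p I * ((norm u)\<^sup>2 / 2 + \<sigma>\<^sup>2 * (risk_level + 4 * excess I) / 2)"
      using posterior_nonneg by (intro mult_left_mono)
    also have "\<dots> = ?p I * ((norm u)\<^sup>2 / 2 + \<sigma>\<^sup>2 * risk_level / 2) + 2 * \<sigma>\<^sup>2 * (?p I * excess I)"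
      by (simp add: algebra_simps)
    also have "\<dots> \<le> ?p I * ((norm u)\<^sup>2 / 2 + \<sigma>\<^sup>2 * risk_level / 2)
        + 2 * \<sigma>\<^sup>2 * (2 * risk_level * ?p I + 4 * exp (- \<nu> * \<rho> I))"
      using posterior_excess_le[OF I] by (intro add_left_mono mult_left_mono) auto
    finally show ?thesis by (simp add: algebra_simps)
  qed
  ultimately have "(norm u)\<^sup>2 \<le> 1 * ((norm u)\<^sup>2 / 2 + 9 / 2 * (\<sigma>\<^sup>2 * risk_level))
        + 8 * \<sigma>\<^sup>2 * (\<Sum>\<^sub>\<infinity>I\<in>\<I>. exp (- \<nu> * \<rho> I))"
    by (rule has_sum_mono)
  then show ?thesis by (simp add: u_def algebra_simps)
qed

text \<open>The bias condition makes the risk level a multiple of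
  \<open>(t + 1) * (1 + \<rho> I0)\<close>, up to a term in m, and the lower bound on the selected
  complexity turns this into the data dependent radius. That costs the factor
  \<open>1 / \<delta>\<close> in K and another term in m.\<close>

lemma estimation_error_le:
  assumes delta: "0 < \<delta>" "\<delta> < 1"
    and tau: "\<tau>0 > (1 + \<delta>) / (1 - \<delta>) * (3 * (1 + \<kappa> * \<alpha>) / \<alpha>)"
    and minimal: "\<And>J. J \<in> \<I> \<Longrightarrow>
      sqdist (L I0) \<theta> + \<tau>0 * \<sigma>\<^sup>2 * \<rho> I0 \<le> sqdist (L J) \<theta> + \<tau>0 * \<sigma>\<^sup>2 * \<rho> J"
    and C: "(\<Sum>\<^sub>\<infinity>I\<in>\<I>. exp (- \<nu> * \<rho> I)) \<le> C" "0 \<le> C"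
    and bias: "0 \<le> t" "sqdist (L I0) \<theta> \<le> t * \<sigma>\<^sup>2 * (1 + \<rho> I0)"
    and estimator: "thetahat \<in> {theta_tilde \<kappa> \<sigma> \<I> L \<rho>, theta_check L Ihat}"
  defines "K \<equiv> (9 * (\<kappa> + 3 / (2 * \<alpha>) + 5 / 4) + 16 * C) / \<delta>"
  shows "(norm (\<theta> - thetahat y))\<^sup>2
    \<le> (t + 1) * K * rhat2 \<sigma> \<rho> Ihat y + ((t + 1) * (K * m) + 27 / (2 * \<alpha>) * m) * \<sigma>\<^sup>2"
proof -
  \<comment> \<open>T dominates 1, \<open>\<rho> I0\<close> and the bias divided by
    \<open>\<sigma>\<^sup>2\<close>, so every term except the one in m is absorbed into it.\<close>
  define T where "T = (t + 1) * (1 + \<rho> I0)"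
  have rho0: "0 \<le> \<rho> I0" by (rule rho_nonneg[OF I0])
  have "1 \<le> T" "\<rho> I0 \<le> T" "t * (1 + \<rho> I0) \<le> T"
    using bias(1) rho0 mult_nonneg_nonneg[of t "\<rho> I0"] unfolding T_def
    by (auto simp: algebra_simps)
  have "(norm (\<theta> - thetahat y))\<^sup>2 \<le> \<sigma>\<^sup>2 * (9 * risk_level + 16 * C)"
  proof -
    have "\<sigma>\<^sup>2 * (9 * risk_level + 16 * (\<Sum>\<^sub>\<infinity>I\<in>\<I>. exp (- \<nu> * \<rho> I)))
        \<le> \<sigma>\<^sup>2 * (9 * risk_level + 16 * C)"
      using C by (intro mult_left_mono) auto
    moreover have "\<sigma>\<^sup>2 * (5 * risk_level) \<le> \<sigma>\<^sup>2 * (9 * risk_level + 16 * C)"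
      using C risk_level_nonneg by (intro mult_left_mono) auto
    ultimately show ?thesis
      using estimator theta_tilde_error theta_check_error by auto
  qed
  also have "9 * risk_level + 16 * C \<le> \<delta> * K * T + 27 / (2 * \<alpha>) * m"
  proof -
    have "\<kappa> * \<rho> I0 \<le> \<kappa> * T" "3 / (2 * \<alpha>) * \<rho> I0 \<le> 3 / (2 * \<alpha>) * T"
      using \<open>\<rho> I0 \<le> T\<close> kappa_ge alpha by (auto intro!: mult_left_mono divide_right_mono)
    moreover have "sqdist (L I0) \<theta> / \<sigma>\<^sup>2 \<le> T"
      using bias(2) \<open>t * (1 + \<rho> I0) \<le> T\<close> sigma
      by (smt (verit) divide_le_eq mult.assoc mult.commute mult_left_mono zero_less_power)
    moreover have "16 * C \<le> 16 * C * T"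
      using C(2) \<open>1 \<le> T\<close> by (simp add: mult_le_cancel_left1)
    moreover have "\<delta> * K = 9 * (\<kappa> + 3 / (2 * \<alpha>) + 5 / 4) + 16 * C"
      using delta unfolding K_def by simp
    then have "\<delta> * K * T
        = 9 * (\<kappa> * T) + 9 * (3 / (2 * \<alpha>) * T) + 9 * (5 / 4 * T) + 16 * C * T"
      by (simp add: algebra_simps)
    moreover have "9 * risk_level = 9 * (\<kappa> * \<rho> I0) + 9 * (5 / 4 * (sqdist (L I0) \<theta> / \<sigma>\<^sup>2))
        + 9 * (3 / (2 * \<alpha>) * \<rho> I0) + 27 / (2 * \<alpha>) * m"
      unfolding risk_level_def by (simp add: add_divide_distrib algebra_simps)
    ultimately show ?thesis by linarith
  qed
  also have "\<delta> * K * T \<le> (t + 1) * K * (1 + \<rho> (Ihat y) + m)"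
  proof -
    have "0 \<le> K" unfolding K_def using C delta alpha kappa_ge by simp
    \<comment> \<open>Both alternatives of the lower bound give this; \<delta> < 1 takes care of the
      first summand.\<close>
    have "\<delta> * (1 + \<rho> I0) \<le> 1 + \<rho> (Ihat y) + m"
      using selected_complexity_lower[OF delta tau minimal] delta m
        rho_nonneg[OF Ihat_in[of y]] rho0 mult_nonneg_nonneg[of \<delta> "\<rho> I0"]
      by (auto simp: algebra_simps)
    then have "(t + 1) * K * (\<delta> * (1 + \<rho> I0)) \<le> (t + 1) * K * (1 + \<rho> (Ihat y) + m)"
      using bias(1) \<open>0 \<le> K\<close> by (intro mult_left_mono) auto
    then show ?thesis unfolding T_def by (simp add: mult_ac)
  qed
  finally have "(norm (\<theta> - thetahat y))\<^sup>2
      \<le> \<sigma>\<^sup>2 * ((t + 1) * K * (1 + \<rho> (Ihat y) + m) + 27 / (2 * \<alpha>) * m)"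
    by (simp add: mult_left_mono)
  then show ?thesis unfolding rhat2_def by (simp add: algebra_simps)
qed

end

section \<open>Tail bounds in the probabilistic model\<close>

locale projection_selection = structure_selection \<alpha> \<nu> \<kappa> \<sigma> \<I> L \<rho> Ihat
  for \<alpha> \<nu> \<kappa> \<sigma> and \<I> :: "'i set" and L :: "'i \<Rightarrow> (real^'n) set" and \<rho> Ihat +
  fixes \<Theta> :: "(real^'n) set" and P :: "real^'n \<Rightarrow> 'w measure" and \<xi> and d :: "'i \<Rightarrow> real"
    and C :: real
  assumes model: "projection_model \<sigma> \<Theta> P \<xi> \<I> L \<rho>"
    and A1: "cond_A1 \<alpha> d \<Theta> P \<xi> \<I> L"
    and A2: "cond_A2 \<nu> C d \<I> \<rho>"
begin

lemma
  assumes "\<theta> \<in> \<Theta>"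
  shows prob_space_P: "prob_space (P \<theta>)" and measurable_noise: "\<xi> \<theta> \<in> borel_measurable (P \<theta>)"
  using model assms unfolding projection_model_def by auto

lemma
  assumes "\<theta> \<in> \<Theta>" "I \<in> \<I>"
  shows integrable_exp_noise:
      "integrable (P \<theta>) (\<lambda>\<omega>. exp (\<alpha> * (norm (orth_proj (L I) (\<xi> \<theta> \<omega>)))\<^sup>2))"
    and ln_exp_noise_le:
      "ln (\<integral>\<omega>. exp (\<alpha> * (norm (orth_proj (L I) (\<xi> \<theta> \<omega>)))\<^sup>2) \<partial>P \<theta>) \<le> \<rho> I"
  using A1 A2 assms unfolding cond_A1_def cond_A2_def by (auto intro: order_trans)

lemma sum_le: "(\<Sum>\<^sub>\<infinity>I\<in>\<I>. exp (- \<nu> * \<rho> I)) \<le> C"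
  using A2 unfolding cond_A2_def by simp

text \<open>The link between the deterministic bounds and probability: it is enough to refute Q for
  every noise value satisfying \<open>noise_control\<close>, since the event is then enclosed in the
  measurable bad event.\<close>

lemma prob_bad_le:
  assumes A3: "cond_A3 \<I> L \<rho>" and \<theta>: "\<theta> \<in> \<Theta>" and I0: "I0 \<in> \<I>" and "0 \<le> m"
    and good: "\<And>\<omega> S. \<omega> \<in> space (P \<theta>) \<Longrightarrow> Q \<omega> \<Longrightarrow>
      noise_control \<alpha> \<nu> \<kappa> \<sigma> \<I> L \<rho> Ihat (\<xi> \<theta> \<omega>) I0 S m \<Longrightarrow> False"
  shows "measure (P \<theta>) {\<omega>\<in>space (P \<theta>). Q \<omega>} \<le> C * exp (- m)"
proof -
  interpret prob_space "P \<theta>" by (rule prob_space_P[OF \<theta>])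
  have "\<forall>I\<in>\<I>. \<exists>J\<in>\<I>. L I \<union> L I0 \<subseteq> L J \<and> \<rho> J \<le> \<rho> I + \<rho> I0"
    using A3 I0 unfolding cond_A3_def by blast
  then obtain S where S: "\<And>I. I \<in> \<I> \<Longrightarrow> S I \<in> \<I>"
      "\<And>I. I \<in> \<I> \<Longrightarrow> L I \<subseteq> L (S I)" "\<And>I. I \<in> \<I> \<Longrightarrow> L I0 \<subseteq> L (S I)"
      "\<And>I. I \<in> \<I> \<Longrightarrow> \<rho> (S I) \<le> \<rho> I + \<rho> I0"
    unfolding bchoice_iff by (metis le_sup_iff)
  define bad where "bad = (\<Union>I\<in>\<I>. {\<omega>\<in>space (P \<theta>).
      (1 + \<nu>) * \<rho> I + \<rho> I0 + m \<le> \<alpha> * (norm (orth_proj (L (S I)) (\<xi> \<theta> \<omega>)))\<^sup>2})"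
  have "countable \<I>" using model unfolding projection_model_def by simp
  note bad = uniform_noise_bound[of \<I> "\<xi> \<theta>" \<alpha> L \<rho> S "\<rho> I0" \<nu> m, folded bad_def,
      OF \<open>countable \<I>\<close> measurable_noise[OF \<theta>] alpha(1) subspaces
        integrable_exp_noise[OF \<theta>] ln_exp_noise_le[OF \<theta>] S(1) S(4) summable]
  have "{\<omega>\<in>space (P \<theta>). Q \<omega>} \<subseteq> bad"
  proof (rule ccontr)
    assume "\<not> ?thesis"
    then obtain \<omega> where \<omega>: "\<omega> \<in> space (P \<theta>)" "Q \<omega>" "\<omega> \<notin> bad" by auto
    then have "noise_control \<alpha> \<nu> \<kappa> \<sigma> \<I> L \<rho> Ihat (\<xi> \<theta> \<omega>) I0 S m"
      using I0 S \<open>0 \<le> m\<close> unfolding bad_def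
      by unfold_locales (auto simp: not_le)
    with \<omega> good show False by blast
  qed
  then have "prob {\<omega>\<in>space (P \<theta>). Q \<omega>} \<le> prob bad"
    using bad(1) by (intro finite_measure_mono) auto
  also have "\<dots> \<le> (\<Sum>\<^sub>\<infinity>I\<in>\<I>. exp (- \<nu> * \<rho> I)) * exp (- m)"
    using bad(2) by simp
  also have "\<dots> \<le> C * exp (- m)"
    using sum_le by (intro mult_right_mono) auto
  finally show ?thesis .
qed

text \<open>The level R is left open so that one bound serves both the oracle risk and
  \<open>\<rho> Io\<close> alone. With m = M/2, the event would give
  \<open>3 / 4 * (2 * a + M) < a + M / 2\<close> for
  \<open>a = (\<alpha> * \<kappa> + 1) * \<rho> Io\<close>, impossible because a and M are
  nonnegative.\<close>

lemma radius_upper_tail: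
  assumes A3: "cond_A3 \<I> L \<rho>" and \<theta>: "\<theta> \<in> \<Theta>" and "0 \<le> M"
    and Io: "is_oracle \<I> L \<rho> \<theta> (\<sigma>\<^sup>2) Io" and level: "2 * (\<alpha> * \<kappa> + 1) * \<rho> Io * \<sigma>\<^sup>2 \<le> R"
  shows "measure (P \<theta>) {\<omega>\<in>space (P \<theta>). rhat2 \<sigma> \<rho> Ihat (obs \<sigma> \<xi> \<theta> \<omega>) \<ge> R + (M + 1) * \<sigma>\<^sup>2}
    \<le> C * exp (- M / 2)"
proof -
  have I: "Io \<in> \<I>" using Io unfolding is_oracle_def is_arg_min_def by simp
  have "measure (P \<theta>) {\<omega>\<in>space (P \<theta>). rhat2 \<sigma> \<rho> Ihat (obs \<sigma> \<xi> \<theta> \<omega>) \<ge> R + (M + 1) * \<sigma>\<^sup>2}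
      \<le> C * exp (- (M / 2))"
  proof (rule prob_bad_le[OF A3 \<theta> I])
    fix \<omega> S
    assume "R + (M + 1) * \<sigma>\<^sup>2 \<le> rhat2 \<sigma> \<rho> Ihat (obs \<sigma> \<xi> \<theta> \<omega>)"
    then have "\<sigma>\<^sup>2 * (2 * ((\<alpha> * \<kappa> + 1) * \<rho> Io) + M) \<le> \<sigma>\<^sup>2 * \<rho> (Ihat (\<theta> + \<sigma> *\<^sub>R \<xi> \<theta> \<omega>))"
      using level unfolding rhat2_def obs_def by (simp add: algebra_simps)
    then have "2 * ((\<alpha> * \<kappa> + 1) * \<rho> Io) + M \<le> \<rho> (Ihat (\<theta> + \<sigma> *\<^sub>R \<xi> \<theta> \<omega>))"
      by (rule mult_left_le_imp_le) (use sigma in simp)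
    moreover assume "noise_control \<alpha> \<nu> \<kappa> \<sigma> \<I> L \<rho> Ihat (\<xi> \<theta> \<omega>) Io S (M / 2)"
    then have "3 / 4 * \<rho> (Ihat (\<theta> + \<sigma> *\<^sub>R \<xi> \<theta> \<omega>)) < (\<alpha> * \<kappa> + 1) * \<rho> Io + M / 2"
      using Io unfolding is_oracle_def is_arg_min_def
      by (intro noise_control.selected_complexity_upper) (auto simp: not_less)
    moreover have "0 \<le> (\<alpha> * \<kappa> + 1) * \<rho> Io"
      using rho_nonneg[OF I] alpha kappa_ge by simp
    ultimately show False using \<open>0 \<le> M\<close> by linarith
  qed (use \<open>0 \<le> M\<close> in simp)
  then show ?thesis by simp
qed

lemma coverage:
  assumes A3: "cond_A3 \<I> L \<rho>" and \<theta>: "\<theta> \<in> \<Theta>" and "0 \<le> M" "0 \<le> C"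
    and delta: "0 < \<delta>" "\<delta> < 1"
    and tau: "\<tau>0 > (1 + \<delta>) / (1 - \<delta>) * (3 * (1 + \<kappa> * \<alpha>) / \<alpha>)"
    and Is: "is_oracle \<I> L \<rho> \<theta> (\<tau>0 * \<sigma>\<^sup>2) Is"
    and bias: "0 \<le> t" "sqdist (L Is) \<theta> \<le> t * \<sigma>\<^sup>2 * (1 + \<rho> Is)"
    and estimator: "thetahat \<in> {theta_tilde \<kappa> \<sigma> \<I> L \<rho>, theta_check L Ihat}"
  defines "K \<equiv> (9 * (\<kappa> + 3 / (2 * \<alpha>) + 5 / 4) + 16 * C) / \<delta>"
  shows "measure (P \<theta>) {\<omega>\<in>space (P \<theta>).
      \<theta> \<notin> pball \<Theta> (thetahat (obs \<sigma> \<xi> \<theta> \<omega>))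
        (sqrt ((t + 1) * K * rhat2 \<sigma> \<rho> Ihat (obs \<sigma> \<xi> \<theta> \<omega>) + (t + 2) * M * \<sigma>\<^sup>2))}
    \<le> C * exp (- (1 / (K + 27 / (2 * \<alpha>))) * M)"
proof -
  have I: "Is \<in> \<I>" using Is unfolding is_oracle_def is_arg_min_def by simp
  \<comment> \<open>m is chosen so that the two deviation terms \<open>K * m\<close> and
    \<open>27 / (2 * \<alpha>) * m\<close> add up to M.\<close>
  define m where "m = M / (K + 27 / (2 * \<alpha>))"
  have K: "0 \<le> K" unfolding K_def using \<open>0 \<le> C\<close> delta alpha kappa_ge by simp
  have pos: "0 < 27 / (2 * \<alpha>)" using alpha by simp
  have "0 \<le> m" unfolding m_def using K pos \<open>0 \<le> M\<close> by simp
  have split: "K * m + 27 / (2 * \<alpha>) * m = M"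
  proof -
    have "K + 27 / (2 * \<alpha>) \<noteq> 0" using K pos by linarith
    then show ?thesis unfolding m_def distrib_right[symmetric] by simp
  qed
  then have le: "K * m \<le> M" "27 / (2 * \<alpha>) * m \<le> M"
    using K pos \<open>0 \<le> m\<close> mult_nonneg_nonneg[of K m] mult_nonneg_nonneg[of "27 / (2 * \<alpha>)" m]
    by linarith+
  have "measure (P \<theta>) {\<omega>\<in>space (P \<theta>).
      \<theta> \<notin> pball \<Theta> (thetahat (obs \<sigma> \<xi> \<theta> \<omega>))
        (sqrt ((t + 1) * K * rhat2 \<sigma> \<rho> Ihat (obs \<sigma> \<xi> \<theta> \<omega>) + (t + 2) * M * \<sigma>\<^sup>2))}
    \<le> C * exp (- m)"
  proof (rule prob_bad_le[OF A3 \<theta> I \<open>0 \<le> m\<close>])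
    fix \<omega> S
    let ?y = "obs \<sigma> \<xi> \<theta> \<omega>"
    assume "noise_control \<alpha> \<nu> \<kappa> \<sigma> \<I> L \<rho> Ihat (\<xi> \<theta> \<omega>) Is S m"
    then have "(norm (\<theta> - thetahat ?y))\<^sup>2
        \<le> (t + 1) * K * rhat2 \<sigma> \<rho> Ihat ?y + ((t + 1) * (K * m) + 27 / (2 * \<alpha>) * m) * \<sigma>\<^sup>2"
      unfolding obs_def K_def
      by (rule noise_control.estimation_error_le[OF _ delta tau _ sum_le \<open>0 \<le> C\<close> bias estimator])
        (use Is in \<open>auto simp: is_oracle_def is_arg_min_def not_less\<close>)
    \<comment> \<open>Each deviation term is at most M, whence the factor \<open>t + 2\<close> of
      the radius.\<close>
    also have "(t + 1) * (K * m) + 27 / (2 * \<alpha>) * m \<le> (t + 1) * M + M"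
      using le bias(1) by (intro add_mono mult_left_mono) auto
    finally have "(norm (\<theta> - thetahat ?y))\<^sup>2
        \<le> (t + 1) * K * rhat2 \<sigma> \<rho> Ihat ?y + (t + 2) * M * \<sigma>\<^sup>2"
      by (simp add: mult_right_mono algebra_simps)
    moreover assume "\<theta> \<notin> pball \<Theta> (thetahat ?y)
        (sqrt ((t + 1) * K * rhat2 \<sigma> \<rho> Ihat ?y + (t + 2) * M * \<sigma>\<^sup>2))"
    ultimately show False
      using \<theta> unfolding pball_def by (auto dest: real_le_rsqrt)
  qed
  then show ?thesis unfolding m_def by simp
qed

lemma r2_oracle_le:
  assumes "is_oracle \<I> L \<rho> \<theta> (\<sigma>\<^sup>2) Io"
  shows "r2 \<sigma> L \<rho> Io \<theta> \<le> oracle_r2 \<sigma> \<I> L \<rho> \<theta>"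
  unfolding oracle_r2_def
  using assms by (intro cINF_greatest) (auto simp: is_oracle_def is_arg_min_def r2_def not_less)

text \<open>The span of all structures replaces the upper bounds \<open>S I\<close>, and its noise
  is controlled through the finite set F. H and c depend on the structures by way of F and B, but
  not on \<theta>; A = 1 suffices.\<close>

lemma radius_tail_without_A3:
  assumes Io: "\<And>\<theta>. \<theta> \<in> \<Theta> \<Longrightarrow> is_oracle \<I> L \<rho> \<theta> (\<sigma>\<^sup>2) (Io \<theta>)"
  shows "\<exists>A H c. A > 0 \<and> H > 0 \<and> c > 0 \<and> (\<forall>M\<ge>0. \<forall>\<theta>\<in>\<Theta>.
    measure (P \<theta>) {\<omega>\<in>space (P \<theta>).
      rhat2 \<sigma> \<rho> Ihat (obs \<sigma> \<xi> \<theta> \<omega>) \<ge> A * oracle_r2 \<sigma> \<I> L \<rho> \<theta> + (M + 1) * \<sigma>\<^sup>2}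
    \<le> H * exp (- c * M))"
proof -
  define W where "W = span (\<Union>I\<in>\<I>. L I)"
  have W: "subspace W" "\<And>I. I \<in> \<I> \<Longrightarrow> L I \<subseteq> W"
    unfolding W_def by (auto intro: span_base)
  obtain F B where F: "finite F" "F \<subseteq> \<I>" and B: "0 < B"
      "\<And>x. norm (orth_proj W x) \<le> B * (\<Sum>I\<in>F. norm (orth_proj (L I) x))"
    by (rule orth_proj_span_Union_le[of \<I> L, OF subspaces, folded W_def]) (assumption, rule that)
  define H where "H = 1 + (\<Sum>I\<in>F. exp (\<rho> I))"
  define c where "c = \<alpha> / (B * (card F + 1))\<^sup>2"
  have "0 < H" unfolding H_def by (intro add_pos_nonneg sum_nonneg) auto
  have "0 < c" unfolding c_def using alpha B(1) by simp
  have "measure (P \<theta>) {\<omega>\<in>space (P \<theta>).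
      rhat2 \<sigma> \<rho> Ihat (obs \<sigma> \<xi> \<theta> \<omega>) \<ge> 1 * oracle_r2 \<sigma> \<I> L \<rho> \<theta> + (M + 1) * \<sigma>\<^sup>2}
    \<le> H * exp (- c * M)" if "0 \<le> M" and \<theta>: "\<theta> \<in> \<Theta>" for M \<theta>
  proof -
    interpret prob_space "P \<theta>" by (rule prob_space_P[OF \<theta>])
    have [measurable]: "(\<lambda>\<omega>. orth_proj W (\<xi> \<theta> \<omega>)) \<in> borel_measurable (P \<theta>)"
      by (rule measurable_compose[OF measurable_noise[OF \<theta>] borel_measurable_orth_proj[OF W(1)]])
    have events: "{\<omega>\<in>space (P \<theta>). M \<le> (norm (orth_proj W (\<xi> \<theta> \<omega>)))\<^sup>2} \<in> events"
      by measurable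
    have I: "Io \<theta> \<in> \<I>" using Io[OF \<theta>] unfolding is_oracle_def is_arg_min_def by simp
    have "{\<omega>\<in>space (P \<theta>).
        rhat2 \<sigma> \<rho> Ihat (obs \<sigma> \<xi> \<theta> \<omega>) \<ge> 1 * oracle_r2 \<sigma> \<I> L \<rho> \<theta> + (M + 1) * \<sigma>\<^sup>2}
      \<subseteq> {\<omega>\<in>space (P \<theta>). M \<le> (norm (orth_proj W (\<xi> \<theta> \<omega>)))\<^sup>2}"
    proof safe
      fix \<omega>
      assume "1 * oracle_r2 \<sigma> \<I> L \<rho> \<theta> + (M + 1) * \<sigma>\<^sup>2 \<le> rhat2 \<sigma> \<rho> Ihat (obs \<sigma> \<xi> \<theta> \<omega>)"
      then have "\<sigma>\<^sup>2 * M \<le> \<sigma>\<^sup>2 * (norm (orth_proj W (\<xi> \<theta> \<omega>)))\<^sup>2"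
        using selected_complexity_span[OF W I, of \<theta> "\<xi> \<theta> \<omega>"] r2_oracle_le[OF Io[OF \<theta>]]
        unfolding rhat2_def obs_def by (simp add: algebra_simps del: power_mono_iff)
      then show "M \<le> (norm (orth_proj W (\<xi> \<theta> \<omega>)))\<^sup>2" using sigma by simp
    qed
    then have "prob {\<omega>\<in>space (P \<theta>).
        rhat2 \<sigma> \<rho> Ihat (obs \<sigma> \<xi> \<theta> \<omega>) \<ge> 1 * oracle_r2 \<sigma> \<I> L \<rho> \<theta> + (M + 1) * \<sigma>\<^sup>2}
      \<le> prob {\<omega>\<in>space (P \<theta>). M \<le> (norm (orth_proj W (\<xi> \<theta> \<omega>)))\<^sup>2}"
      using events by (rule finite_measure_mono)
    also have "\<dots> \<le> H * exp (- (c * M))"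
      unfolding H_def c_def
    proof (rule span_noise_tail[OF _ F(1) B(1) alpha(1) measurable_noise[OF \<theta>] _ _ B(2) \<open>0 \<le> M\<close>])
      fix I assume "I \<in> F"
      then have "I \<in> \<I>" using F(2) by blast
      then show "subspace (L I)"
        "integrable (P \<theta>) (\<lambda>\<omega>. exp (\<alpha> * (norm (orth_proj (L I) (\<xi> \<theta> \<omega>)))\<^sup>2))"
        "ln (\<integral>\<omega>. exp (\<alpha> * (norm (orth_proj (L I) (\<xi> \<theta> \<omega>)))\<^sup>2) \<partial>P \<theta>) \<le> \<rho> I"
        by (rule subspaces integrable_exp_noise[OF \<theta>] ln_exp_noise_le[OF \<theta>])+
    qed
    finally show ?thesis by simp
  qed
  then show ?thesis using \<open>0 < H\<close> \<open>0 < c\<close> by (intro exI[of _ 1] exI[of _ H] exI[of _ c]) auto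
qed

end

section \<open>The strong closure condition and the choice of constants\<close>

lemma cond_A3_strong_imp_cond_A3:
  assumes "cond_A3_strong \<I> L \<rho>" "\<And>I. I \<in> \<I> \<Longrightarrow> subspace (L I)"
  shows "cond_A3 \<I> L \<rho>"
  unfolding cond_A3_def
proof (intro ballI)
  fix I0 I1 assume I: "I0 \<in> \<I>" "I1 \<in> \<I>"
  then obtain I' where I': "I' \<in> \<I>" "L I' = {x + y |x y. x \<in> L I0 \<and> y \<in> L I1}"
      "\<rho> I' \<le> \<rho> I0 + \<rho> I1"
    using assms(1) unfolding cond_A3_strong_def by blast
  \<comment> \<open>As 0 lies in both subspaces, each of them is contained in their sum.\<close>
  have "0 \<in> L I0" "0 \<in> L I1" using I assms(2) subspace_0 by blast+
  then have "L I0 \<union> L I1 \<subseteq> L I'"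
    unfolding I'(2) by (auto; metis add_0 add_0_right)
  with I' show "\<exists>I'\<in>\<I>. L I0 \<union> L I1 \<subseteq> L I' \<and> \<rho> I' \<le> \<rho> I0 + \<rho> I1" by blast
qed

theorem theorem4p3:
  fixes \<alpha> \<nu> C\<^sub>\<nu> \<kappa> \<delta> \<tau>0 :: real
  assumes "0 < \<alpha>" "\<alpha> \<le> 1" "\<nu> > 0" "C\<^sub>\<nu> > 0"
    and "\<kappa> > (32 * \<nu> + 10 + \<alpha>) / (4 * \<alpha>)"
    and "0 < \<delta>" "\<delta> < 1"
    and "\<tau>0 > (1 + \<delta>) / (1 - \<delta>) * (3 * (1 + \<kappa> * \<alpha>) / \<alpha>)"
  shows
    "\<exists>M2 M3 H2 H3 m2 m3 M0' :: real.
       M2 > 0 \<and> M3 > 0 \<and> H2 > 0 \<and> H3 > 0 \<and> m2 > 0 \<and> m3 > 0 \<and> M0' > 0 \<and>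
       (\<forall>\<sigma> \<Theta> (P :: real^'n \<Rightarrow> 'w measure) \<xi> (\<I> :: 'i set) L \<rho> d Ihat Io Istar.
          projection_model \<sigma> \<Theta> P \<xi> \<I> L \<rho> \<and>
          selector \<kappa> \<sigma> \<I> L \<rho> Ihat \<and>
          (\<forall>\<theta>\<in>\<Theta>. is_oracle \<I> L \<rho> \<theta> (\<sigma>\<^sup>2) (Io \<theta>)) \<and>
          (\<forall>\<theta>\<in>\<Theta>. is_oracle \<I> L \<rho> \<theta> (\<tau>0 * \<sigma>\<^sup>2) (Istar \<theta>)) \<and>
          cond_A1 \<alpha> d \<Theta> P \<xi> \<I> L \<and> cond_A2 \<nu> C\<^sub>\<nu> d \<I> \<rho> \<longrightarrow>
          (cond_A3 \<I> L \<rho> \<longrightarrow>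
             (\<forall>thetahat \<in> {theta_tilde \<kappa> \<sigma> \<I> L \<rho>, theta_check L Ihat}.
                \<forall>t\<ge>0. \<forall>M\<ge>0. \<forall>\<theta>\<in>Theta_eb \<sigma> \<Theta> L \<rho> Istar t.
                  measure (P \<theta>) {\<omega>\<in>space (P \<theta>).
                    \<theta> \<notin> pball \<Theta> (thetahat (obs \<sigma> \<xi> \<theta> \<omega>))
                      (sqrt ((t + 1) * M2 * rhat2 \<sigma> \<rho> Ihat (obs \<sigma> \<xi> \<theta> \<omega>) + (t + 2) * M * \<sigma>\<^sup>2))}
                  \<le> H2 * exp (- m2 * M)) \<and>
             (\<forall>M\<ge>0. \<forall>\<theta>\<in>\<Theta>.
                measure (P \<theta>) {\<omega>\<in>space (P \<theta>).
                  rhat2 \<sigma> \<rho> Ihat (obs \<sigma> \<xi> \<theta> \<omega>) \<ge> M3 * oracle_r2 \<sigma> \<I> L \<rho> \<theta> + (M + 1) * \<sigma>\<^sup>2}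
                \<le> H3 * exp (- m3 * M))) \<and>
          (\<exists>M3' H3' m3' :: real. M3' > 0 \<and> H3' > 0 \<and> m3' > 0 \<and>
             (\<forall>M\<ge>0. \<forall>\<theta>\<in>\<Theta>.
                measure (P \<theta>) {\<omega>\<in>space (P \<theta>).
                  rhat2 \<sigma> \<rho> Ihat (obs \<sigma> \<xi> \<theta> \<omega>) \<ge> M3' * oracle_r2 \<sigma> \<I> L \<rho> \<theta> + (M + 1) * \<sigma>\<^sup>2}
                \<le> H3' * exp (- m3' * M))) \<and>
          (cond_A3_strong \<I> L \<rho> \<longrightarrow>
             (\<forall>M\<ge>0. \<forall>\<theta>\<in>\<Theta>.
                measure (P \<theta>) {\<omega>\<in>space (P \<theta>).
                  rhat2 \<sigma> \<rho> Ihat (obs \<sigma> \<xi> \<theta> \<omega>)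
                    \<ge> M0' * \<rho> (Io \<theta>) * \<sigma>\<^sup>2 + (M + 1) * \<sigma>\<^sup>2}
                \<le> C\<^sub>\<nu> * exp (- M / 2))))"
proof -
  \<comment> \<open>K and \<open>m2\<close> are the constants of \<open>coverage\<close>, A that of
    \<open>radius_upper_tail\<close>; none depends on \<sigma>, on the structures or on
    \<theta>.\<close>
  define K where "K = (9 * (\<kappa> + 3 / (2 * \<alpha>) + 5 / 4) + 16 * C\<^sub>\<nu>) / \<delta>"
  define m2 where "m2 = 1 / (K + 27 / (2 * \<alpha>))"
  define A where "A = 2 * (\<alpha> * \<kappa> + 1)"
  have "0 < (32 * \<nu> + 10 + \<alpha>) / (4 * \<alpha>)" using assms(1,3) by simp
  then have "0 < \<kappa>" using assms(5) by linarith
  have "0 < K" unfolding K_def using assms(1,4,6) \<open>0 < \<kappa>\<close> by (simp add: add_pos_pos)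
  then have "0 < m2" unfolding m2_def using assms(1) by (simp add: add_pos_pos)
  have "0 < A" unfolding A_def using assms(1) \<open>0 < \<kappa>\<close> by (simp add: add_pos_pos)
  show ?thesis
  proof (rule exI[of _ K], rule exI[of _ A], rule exI[of _ "C\<^sub>\<nu>"], rule exI[of _ "C\<^sub>\<nu>"],
      rule exI[of _ m2], rule exI[of _ "1 / 2"], rule exI[of _ A], intro conjI allI impI)
    fix \<sigma> and \<Theta> :: "(real^'n) set" and P :: "real^'n \<Rightarrow> 'w measure" and \<xi>
      and \<I> :: "'i set" and L \<rho> d Ihat Io Istar
    assume H: "projection_model \<sigma> \<Theta> P \<xi> \<I> L \<rho> \<and>
      selector \<kappa> \<sigma> \<I> L \<rho> Ihat \<and>
      (\<forall>\<theta>\<in>\<Theta>. is_oracle \<I> L \<rho> \<theta> (\<sigma>\<^sup>2) (Io \<theta>)) \<and>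
      (\<forall>\<theta>\<in>\<Theta>. is_oracle \<I> L \<rho> \<theta> (\<tau>0 * \<sigma>\<^sup>2) (Istar \<theta>)) \<and>
      cond_A1 \<alpha> d \<Theta> P \<xi> \<I> L \<and> cond_A2 \<nu> C\<^sub>\<nu> d \<I> \<rho>"
    then have Io: "\<And>\<theta>. \<theta> \<in> \<Theta> \<Longrightarrow> is_oracle \<I> L \<rho> \<theta> (\<sigma>\<^sup>2) (Io \<theta>)"
      and Istar: "\<And>\<theta>. \<theta> \<in> \<Theta> \<Longrightarrow> is_oracle \<I> L \<rho> \<theta> (\<tau>0 * \<sigma>\<^sup>2) (Istar \<theta>)"
      by auto
    interpret projection_selection \<alpha> \<nu> \<kappa> \<sigma> \<I> L \<rho> Ihat \<Theta> P \<xi> d "C\<^sub>\<nu>"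
      using H assms(1-5) unfolding projection_model_def cond_A2_def
      by unfold_locales (auto simp: projection_model_def cond_A2_def)
    show "\<forall>thetahat \<in> {theta_tilde \<kappa> \<sigma> \<I> L \<rho>, theta_check L Ihat}.
        \<forall>t\<ge>0. \<forall>M\<ge>0. \<forall>\<theta>\<in>Theta_eb \<sigma> \<Theta> L \<rho> Istar t.
          measure (P \<theta>) {\<omega>\<in>space (P \<theta>).
            \<theta> \<notin> pball \<Theta> (thetahat (obs \<sigma> \<xi> \<theta> \<omega>))
              (sqrt ((t + 1) * K * rhat2 \<sigma> \<rho> Ihat (obs \<sigma> \<xi> \<theta> \<omega>) + (t + 2) * M * \<sigma>\<^sup>2))}
          \<le> C\<^sub>\<nu> * exp (- m2 * M)" if A3: "cond_A3 \<I> L \<rho>"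
    proof (intro ballI allI impI)
      fix thetahat t M \<theta>
      assume hat: "thetahat \<in> {theta_tilde \<kappa> \<sigma> \<I> L \<rho>, theta_check L Ihat}"
        and "0 \<le> (t::real)" "0 \<le> (M::real)" and eb: "\<theta> \<in> Theta_eb \<sigma> \<Theta> L \<rho> Istar t"
      then have \<theta>: "\<theta> \<in> \<Theta>" and bias: "sqdist (L (Istar \<theta>)) \<theta> \<le> t * \<sigma>\<^sup>2 * (1 + \<rho> (Istar \<theta>))"
        unfolding Theta_eb_def by auto
      show "measure (P \<theta>) {\<omega>\<in>space (P \<theta>).
            \<theta> \<notin> pball \<Theta> (thetahat (obs \<sigma> \<xi> \<theta> \<omega>))
              (sqrt ((t + 1) * K * rhat2 \<sigma> \<rho> Ihat (obs \<sigma> \<xi> \<theta> \<omega>) + (t + 2) * M * \<sigma>\<^sup>2))}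
          \<le> C\<^sub>\<nu> * exp (- m2 * M)"
        unfolding m2_def K_def
        by (rule coverage[OF A3 \<theta> \<open>0 \<le> M\<close> less_imp_le[OF assms(4)] assms(6-8) Istar[OF \<theta>]
              \<open>0 \<le> t\<close> bias hat])
    qed
    show "\<forall>\<theta>\<in>\<Theta>. measure (P \<theta>) {\<omega>\<in>space (P \<theta>).
          rhat2 \<sigma> \<rho> Ihat (obs \<sigma> \<xi> \<theta> \<omega>) \<ge> A * oracle_r2 \<sigma> \<I> L \<rho> \<theta> + (M + 1) * \<sigma>\<^sup>2}
        \<le> C\<^sub>\<nu> * exp (- (1 / 2) * M)" if A3: "cond_A3 \<I> L \<rho>" and "0 \<le> M" for M
    proof
      fix \<theta> assume "\<theta> \<in> \<Theta>"
      \<comment> \<open>The oracle complexity is part of the oracle risk, so A times that risk is an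
        admissible level R.\<close>
      have "\<rho> (Io \<theta>) * \<sigma>\<^sup>2 \<le> r2 \<sigma> L \<rho> (Io \<theta>) \<theta>" unfolding r2_def by simp
      also have "\<dots> \<le> oracle_r2 \<sigma> \<I> L \<rho> \<theta>" by (rule r2_oracle_le[OF Io[OF \<open>\<theta> \<in> \<Theta>\<close>]])
      finally have "A * (\<rho> (Io \<theta>) * \<sigma>\<^sup>2) \<le> A * oracle_r2 \<sigma> \<I> L \<rho> \<theta>"
        using \<open>0 < A\<close> by simp
      then show "measure (P \<theta>) {\<omega>\<in>space (P \<theta>).
          rhat2 \<sigma> \<rho> Ihat (obs \<sigma> \<xi> \<theta> \<omega>) \<ge> A * oracle_r2 \<sigma> \<I> L \<rho> \<theta> + (M + 1) * \<sigma>\<^sup>2}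
        \<le> C\<^sub>\<nu> * exp (- (1 / 2) * M)"
        using radius_upper_tail[OF A3 \<open>\<theta> \<in> \<Theta>\<close> \<open>0 \<le> M\<close> Io[OF \<open>\<theta> \<in> \<Theta>\<close>]]
        unfolding A_def by (simp add: mult.assoc)
    qed
    show "\<exists>M3' H3' m3' :: real. M3' > 0 \<and> H3' > 0 \<and> m3' > 0 \<and>
        (\<forall>M\<ge>0. \<forall>\<theta>\<in>\<Theta>.
          measure (P \<theta>) {\<omega>\<in>space (P \<theta>).
            rhat2 \<sigma> \<rho> Ihat (obs \<sigma> \<xi> \<theta> \<omega>) \<ge> M3' * oracle_r2 \<sigma> \<I> L \<rho> \<theta> + (M + 1) * \<sigma>\<^sup>2}
          \<le> H3' * exp (- m3' * M))"
      by (rule radius_tail_without_A3[OF Io])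
    show "\<forall>\<theta>\<in>\<Theta>. measure (P \<theta>) {\<omega>\<in>space (P \<theta>).
          rhat2 \<sigma> \<rho> Ihat (obs \<sigma> \<xi> \<theta> \<omega>) \<ge> A * \<rho> (Io \<theta>) * \<sigma>\<^sup>2 + (M + 1) * \<sigma>\<^sup>2}
        \<le> C\<^sub>\<nu> * exp (- M / 2)" if "cond_A3_strong \<I> L \<rho>" and "0 \<le> M" for M
      using radius_upper_tail[OF cond_A3_strong_imp_cond_A3[OF that(1) subspaces] _ that(2) Io]
      unfolding A_def by blast
  qed (use assms(4) \<open>0 < K\<close> \<open>0 < m2\<close> \<open>0 < A\<close> in auto)
qed

end
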